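(* Let $\mathcal{S}=\mathcal{L}\oplus\mathcal{F}^{-1/2}$ be the Krichever–Novikov Lie superalgebra of $(\Sigma,A,L)$ with the almost-grading induced by a splitting $A=I\cup O$. Every bounded (from above) cocycle of $\mathcal{S}$ yielding a central extension with odd central element, i.e. every bounded odd super-cocycle $c:\mathcal{S}\times\mathcal{S}\to\mathbb{C}$, is a coboundary.
   Context: **Algebras.** $\Sigma$ is a compact Riemann surface of arbitrary genus $g$, $A\subset\Sigma$ a finite set, $\mathcal{K}$ the canonical line bundle, $L$ a fixed line bundle with $L^{\otimes 2}=\mathcal{K}$ (theta characteristic). For $\lambda\in\frac12\mathbb{Z}$, $\mathcal{K}^\lambda:=L^{\otimes 2\lambda}$ (negative powers via the dual bundle), and $\mathcal{F}^\lambda$ is the complex vector space of global meromorphic sections of $\mathcal{K}^\lambda$ holomorphic on $\Sigma\setminus A$. Locally elements are $f(z)(dz)^\lambda$; the same symbol is used for a section and its local representing function, and $'$ is $d/dz$. $\mathcal{L}:=\mathcal{F}^{-1}$ (vector fields) with the Lie bracket $[e,f]=(ef'-fe')\frac{d}{dz}$. For $e\in\mathcal{L}$, $\varphi\in\mathcal{F}^{-1/2}$: $e.\varphi=(e\varphi'-\frac12\varphi e')(dz)^{-1/2}$. For $\varphi,\psi\in\mathcal{F}^{-1/2}$, $\varphi\cdot\psi\in\mathcal{L}$ is the product of sections. $\mathcal{S}:=\mathcal{L}\oplus\mathcal{F}^{-1/2}$, with even part $\mathcal{S}_{\bar0}=\mathcal{L}$, odd part $\mathcal{S}_{\bar1}=\mathcal{F}^{-1/2}$,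 is the Lie superalgebra with bracket extending that of $\mathcal{L}$ by $[e,\varphi]=-[\varphi,e]=e.\varphi$, $[\varphi,\psi]=\varphi\cdot\psi$. **Cocycles (odd central element).** An odd super-cocycle is a bilinear $c:\mathcal{S}\times\mathcal{S}\to\mathbb{C}$ vanishing on pairs of elements of equal parity, with $c(x,y)=-(-1)^{\bar x\bar y}c(y,x)$ and $$(-1)^{\bar x\bar z}c(x,[y,z])+(-1)^{\bar y\bar x}c(y,[z,x])+(-1)^{\bar z\bar y}c(z,[x,y])=0$$ for $x,y,z$ of pure parity. It is a coboundary if there is a linear form $k:\mathcal{S}\to\mathbb{C}$ (which may be taken odd, i.e. vanishing on $\mathcal{S}_{\bar0}$) with $c(x,y)=k([x,y])$ for all $x,y\in\mathcal{S}$. **Almost-grading.** $A=I\cup O$ is a fixed splitting into nonempty disjoint sets $I=\{P_1,\dots,P_K\}$, $O=\{Q_1,\dots,Q_M\}$. A separating cycle $C_S$ is a smooth cycle in $\Sigma\setminus A$ homologous there to the sum of small positively oriented circles around the points $P_i$. The Krichever–Novikov pairing is $\mathcal{F}^\lambda\times\mathcal{F}^{1-\lambda}\to\mathbb{C}$, $\langle f,g\rangle=\frac1{2\pi\mathrm{i}}\int_{C_S}f\cdot g$. Let $\mathbb{J}_\lambda=\mathbb{Z}$ for $\lambda\in\mathbb{Z}$, $\mathbb{J}_\lambda=\mathbb{Z}+\frac12$ for $\lambda\in\mathbb{Z}+\frac12$. Fix local coordinates $z_p$ centered at $P_p$. One fixes Krichever–Novikov bases $\{f^\lambda_{n,p}\mid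 n\in\mathbb{J}_\lambda,\ 1\le p\le K\}$ of $\mathcal{F}^\lambda$ (known to exist; needed for $\lambda\in\{-1,-\frac12,\frac32,2\}$) with: (1) $\mathrm{ord}_{P_i}(f^\lambda_{n,p})\ge(n+1-\lambda)-\delta_i^p$ for all $i$ (with equality generically), and $f^\lambda_{n,p}=z_p^{\,n-\lambda}(1+O(z_p))(dz_p)^\lambda$ near $P_p$; (2) duality $\langle f^\lambda_{n,p},f^{1-\lambda}_{-m,r}\rangle=\delta_p^r\delta_n^m$; (3) at the out-points, $\mathrm{ord}_{Q_j}(f^\lambda_{n,p})\ge-\alpha_j n-B$ for all $n,p,j$, with constants $\alpha_j>0$, $\sum_j\alpha_j=K$, and $B$ independent of $n,p,\lambda$. Put $\mathcal{F}^\lambda_n=\mathrm{span}\{f^\lambda_{n,p}\mid p=1,\dots,K\}$, and for $n\in\frac12\mathbb{Z}$ let $\mathcal{S}_n=\mathcal{F}^{-1}_n$ if $n\in\mathbb{Z}$, $\mathcal{S}_n=\mathcal{F}^{-1/2}_n$ if $n\in\mathbb{Z}+\frac12$. Then $\mathcal{S}=\bigoplus_n\mathcal{S}_n$ is almost-graded: $\dim\mathcal{S}_n<\infty$ and there are constants $L_1,L_2$ with $[\mathcal{S}_n,\mathcal{S}_m]\subseteq\bigoplus_{h=n+m-L_1}^{n+m+L_2}\mathcal{S}_h$ for all $n,m$. **Bounded.** A cocycle $c$ is bounded (from above) if there is $M_2\in\mathbb{Z}$ such that for all $n,m$: $c(\mathcal{S}_n,\mathcal{S}_m)\ne0\Rightarrow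 n+m\le M_2$. *)

theory Defs
  imports
    "HOL-Complex_Analysis.Complex_Analysis"
    "HOL-Homology.Homology"
    "HOL-Library.Landau_Symbols"
    "HOL-Library.Function_Algebras"
begin

section \<open>Compact Riemann surfaces\<close>

text \<open>
  A surface is a topological space with an indexed holomorphic atlas, which need not be maximal.
  The chart with index \<open>\<alpha>\<close> is the map \<open>coord R \<alpha>\<close> on the open set \<open>patch R \<alpha>\<close>; its values
  elsewhere are irrelevant.
\<close>

record ('a, 'i) surface =
  base :: "'a topology"
  charts :: "'i set"
  patch :: "'i \<Rightarrow> 'a set"
  coord :: "'i \<Rightarrow> 'a \<Rightarrow> complex"

definition chart_inv :: "('a, 'i) surface \<Rightarrow> 'i \<Rightarrow> complex \<Rightarrow> 'a" where
  "chart_inv R \<alpha> = inv_into (patch R \<alpha>) (coord R \<alpha>)"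

definition riemann_surface :: "('a, 'i) surface \<Rightarrow> bool" where
  "riemann_surface R \<longleftrightarrow>
     Hausdorff_space (base R) \<and> connected_space (base R) \<and> topspace (base R) \<noteq> {} \<and>
     (\<Union>\<alpha>\<in>charts R. patch R \<alpha>) = topspace (base R) \<and>
     (\<forall>\<alpha>\<in>charts R. openin (base R) (patch R \<alpha>) \<and> open (coord R \<alpha> ` patch R \<alpha>) \<and>
        homeomorphic_map (subtopology (base R) (patch R \<alpha>))
          (top_of_set (coord R \<alpha> ` patch R \<alpha>)) (coord R \<alpha>)) \<and>
     (\<forall>\<alpha>\<in>charts R. \<forall>\<beta>\<in>charts R.
        (coord R \<beta> \<circ> chart_inv R \<alpha>) holomorphic_on coord R \<alpha> ` (patch R \<alpha> \<inter> patch R \<beta>))"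

definition compact_riemann_surface :: "('a, 'i) surface \<Rightarrow> bool" where
  "compact_riemann_surface R \<longleftrightarrow> riemann_surface R \<and> compact_space (base R)"


section \<open>Line bundles and meromorphic sections\<close>

text \<open>
  A holomorphic line bundle is given by its transition functions over the charts of the atlas: with
  local frames \<open>s\<^sub>\<alpha>\<close>, a section \<open>f\<^sub>\<alpha> s\<^sub>\<alpha>\<close> satisfies \<open>f\<^sub>\<alpha> = B \<alpha> \<beta> f\<^sub>\<beta>\<close> on overlaps. As the atlas is
  arbitrary, every line bundle on a surface is of this form after refining the atlas, and
  different frames may be used over the same coordinate map because charts are indexed.
  Tensor powers are powers of transition functions, negative powers being powers of the dual.
\<close>

type_synonym ('a, 'i) trans_funs = "'i \<Rightarrow> 'i \<Rightarrow> 'a \<Rightarrow> complex"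

definition line_bundle :: "('a, 'i) surface \<Rightarrow> ('a, 'i) trans_funs \<Rightarrow> bool" where
  "line_bundle R B \<longleftrightarrow>
     (\<forall>\<alpha>\<in>charts R. \<forall>\<beta>\<in>charts R.
        (B \<alpha> \<beta> \<circ> chart_inv R \<alpha>) holomorphic_on coord R \<alpha> ` (patch R \<alpha> \<inter> patch R \<beta>) \<and>
        (\<forall>x\<in>patch R \<alpha> \<inter> patch R \<beta>. B \<alpha> \<beta> x \<noteq> 0)) \<and>
     (\<forall>\<alpha>\<in>charts R. \<forall>\<beta>\<in>charts R. \<forall>\<gamma>\<in>charts R. \<forall>x\<in>patch R \<alpha> \<inter> patch R \<beta> \<inter> patch R \<gamma>.
        B \<alpha> \<beta> x * B \<beta> \<gamma> x = B \<alpha> \<gamma> x)"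

definition bundle_power :: "('a, 'i) trans_funs \<Rightarrow> int \<Rightarrow> ('a, 'i) trans_funs" where
  "bundle_power B k = (\<lambda>\<alpha> \<beta> x. B \<alpha> \<beta> x powi k)"

text \<open>The frames of the canonical bundle are the \<open>dz\<^sub>\<alpha>\<close>, so its transition functions are
  \<open>dz\<^sub>\<beta> / dz\<^sub>\<alpha>\<close>.\<close>

definition canonical_bundle :: "('a, 'i) surface \<Rightarrow> ('a, 'i) trans_funs" where
  "canonical_bundle R = (\<lambda>\<alpha> \<beta> x. deriv (coord R \<beta> \<circ> chart_inv R \<alpha>) (coord R \<alpha> x))"

text \<open>
  \<open>L\<^sup>2 = K\<close>, with the frame of \<open>L\<close> over the chart \<open>\<alpha>\<close> playing the role of a chosen square root
  of \<open>dz\<^sub>\<alpha>\<close>. Any isomorphism of \<open>L\<^sup>2\<close> with \<open>K\<close> becomes this equality after rescaling the frames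
  over simply connected charts.
\<close>

definition theta_characteristic :: "('a, 'i) surface \<Rightarrow> ('a, 'i) trans_funs \<Rightarrow> bool" where
  "theta_characteristic R L \<longleftrightarrow> line_bundle R L \<and>
     (\<forall>\<alpha>\<in>charts R. \<forall>\<beta>\<in>charts R. \<forall>x\<in>patch R \<alpha> \<inter> patch R \<beta>.
        bundle_power L 2 \<alpha> \<beta> x = canonical_bundle R \<alpha> \<beta> x)"

text \<open>A section is the family of its local representing functions, as functions on the surface.\<close>

type_synonym ('a, 'i) sect = "'i \<Rightarrow> 'a \<Rightarrow> complex"

definition local_rep :: "('a, 'i) surface \<Rightarrow> 'i \<Rightarrow> ('a, 'i) sect \<Rightarrow> complex \<Rightarrow> complex" where
  "local_rep R \<alpha> s = s \<alpha> \<circ> chart_inv R \<alpha>"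

text \<open>
  Global meromorphic sections, holomorphic off the set \<open>A\<close>. The first clause fixes the irrelevant
  values (outside the domains, and at the possible poles) to \<open>0\<close>, so that equality of
  sections is equality of functions.
\<close>

definition mero_sections ::
  "('a, 'i) surface \<Rightarrow> ('a, 'i) trans_funs \<Rightarrow> 'a set \<Rightarrow> ('a, 'i) sect set" where
  "mero_sections R B A = {s.
     (\<forall>\<alpha> x. \<not> (\<alpha> \<in> charts R \<and> x \<in> patch R \<alpha> - A) \<longrightarrow> s \<alpha> x = 0) \<and>
     (\<forall>\<alpha>\<in>charts R. \<forall>\<beta>\<in>charts R. \<forall>x\<in>(patch R \<alpha> \<inter> patch R \<beta>) - A.
        s \<alpha> x = B \<alpha> \<beta> x * s \<beta> x) \<and>
     (\<forall>\<alpha>\<in>charts R. local_rep R \<alpha> s holomorphic_on coord R \<alpha> ` (patch R \<alpha> - A) \<and>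
                   local_rep R \<alpha> s meromorphic_on coord R \<alpha> ` patch R \<alpha>)}"

text \<open>Sections of \<open>K\<^sup>\<lambda> = L\<^sup>2\<^sup>\<lambda>\<close> for half-integers \<open>\<lambda>\<close>.\<close>

definition F_space ::
  "('a, 'i) surface \<Rightarrow> ('a, 'i) trans_funs \<Rightarrow> 'a set \<Rightarrow> real \<Rightarrow> ('a, 'i) sect set" where
  "F_space R L A lam = mero_sections R (bundle_power L \<lfloor>2 * lam\<rfloor>) A"

text \<open>The order at a point, computed in the chart \<open>\<alpha>\<close> (it does not depend on this choice).\<close>

definition sect_ord :: "('a, 'i) surface \<Rightarrow> 'i \<Rightarrow> ('a, 'i) sect \<Rightarrow> 'a \<Rightarrow> ereal" where
  "sect_ord R \<alpha> s x =
     (if \<forall>\<^sub>F w in at (coord R \<alpha> x). local_rep R \<alpha> s w = 0 then \<infinity>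
      else ereal (of_int (zorder (local_rep R \<alpha> s) (coord R \<alpha> x))))"


section \<open>The Krichever-Novikov superalgebra\<close>

text \<open>
  Outside the chart domains and on \<open>A\<close> the derivative takes irrelevant values; in the brackets below
  it only occurs multiplied by a section, which vanishes there.
\<close>

definition sect_deriv :: "('a, 'i) surface \<Rightarrow> ('a, 'i) sect \<Rightarrow> ('a, 'i) sect" where
  "sect_deriv R s = (\<lambda>\<alpha> x. deriv (local_rep R \<alpha> s) (coord R \<alpha> x))"

definition sect_mult :: "('a, 'i) sect \<Rightarrow> ('a, 'i) sect \<Rightarrow> ('a, 'i) sect" where
  "sect_mult s t = (\<lambda>\<alpha> x. s \<alpha> x * t \<alpha> x)"

definition sect_scale :: "complex \<Rightarrow> ('a, 'i) sect \<Rightarrow> ('a, 'i) sect" where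
  "sect_scale a s = (\<lambda>\<alpha> x. a * s \<alpha> x)"

definition vf_bracket ::
  "('a, 'i) surface \<Rightarrow> ('a, 'i) sect \<Rightarrow> ('a, 'i) sect \<Rightarrow> ('a, 'i) sect" where
  "vf_bracket R e f = (\<lambda>\<alpha> x. e \<alpha> x * sect_deriv R f \<alpha> x - f \<alpha> x * sect_deriv R e \<alpha> x)"

definition vf_action ::
  "('a, 'i) surface \<Rightarrow> ('a, 'i) sect \<Rightarrow> ('a, 'i) sect \<Rightarrow> ('a, 'i) sect" where
  "vf_action R e \<phi> =
     (\<lambda>\<alpha> x. e \<alpha> x * sect_deriv R \<phi> \<alpha> x - 1 / 2 * \<phi> \<alpha> x * sect_deriv R e \<alpha> x)"

text \<open>The pair \<open>(e, \<phi>)\<close> stands for \<open>e + \<phi>\<close> in the direct sum of vector fields and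
  \<open>(-1/2)\<close>-forms.\<close>

type_synonym ('a, 'i) selem = "('a, 'i) sect \<times> ('a, 'i) sect"

definition S_space ::
  "('a, 'i) surface \<Rightarrow> ('a, 'i) trans_funs \<Rightarrow> 'a set \<Rightarrow> ('a, 'i) selem set" where
  "S_space R L A = F_space R L A (-1) \<times> F_space R L A (-1/2)"

definition S_parity ::
  "('a, 'i) surface \<Rightarrow> ('a, 'i) trans_funs \<Rightarrow> 'a set \<Rightarrow> nat \<Rightarrow> ('a, 'i) selem set" where
  "S_parity R L A a =
     (if a = 0 then F_space R L A (-1) \<times> {0} else {0} \<times> F_space R L A (-1/2))"

definition S_scale :: "complex \<Rightarrow> ('a, 'i) selem \<Rightarrow> ('a, 'i) selem" where
  "S_scale a x = (sect_scale a (fst x), sect_scale a (snd x))"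

definition S_bracket ::
  "('a, 'i) surface \<Rightarrow> ('a, 'i) selem \<Rightarrow> ('a, 'i) selem \<Rightarrow> ('a, 'i) selem" where
  "S_bracket R x y =
     (vf_bracket R (fst x) (fst y) + sect_mult (snd x) (snd y),
      vf_action R (fst x) (snd y) - vf_action R (fst y) (snd x))"


section \<open>Odd cocycles\<close>

text \<open>Forms on the superalgebra are functions on the ambient type of which only the values on
  \<open>S_space\<close> matter.\<close>

definition S_linear ::
  "('a, 'i) surface \<Rightarrow> ('a, 'i) trans_funs \<Rightarrow> 'a set \<Rightarrow> (('a, 'i) selem \<Rightarrow> complex) \<Rightarrow> bool" where
  "S_linear R L A k \<longleftrightarrow>
     (\<forall>x\<in>S_space R L A. \<forall>y\<in>S_space R L A. k (x + y) = k x + k y) \<and>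
     (\<forall>a. \<forall>x\<in>S_space R L A. k (S_scale a x) = a * k x)"

definition S_bilinear ::
  "('a, 'i) surface \<Rightarrow> ('a, 'i) trans_funs \<Rightarrow> 'a set \<Rightarrow>
     (('a, 'i) selem \<Rightarrow> ('a, 'i) selem \<Rightarrow> complex) \<Rightarrow> bool" where
  "S_bilinear R L A c \<longleftrightarrow>
     (\<forall>x\<in>S_space R L A. S_linear R L A (c x)) \<and>
     (\<forall>y\<in>S_space R L A. S_linear R L A (\<lambda>x. c x y))"

definition odd_supercocycle ::
  "('a, 'i) surface \<Rightarrow> ('a, 'i) trans_funs \<Rightarrow> 'a set \<Rightarrow>
     (('a, 'i) selem \<Rightarrow> ('a, 'i) selem \<Rightarrow> complex) \<Rightarrow> bool" where
  "odd_supercocycle R L A c \<longleftrightarrow> S_bilinear R L A c \<and>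
     (\<forall>a\<in>{0,1}. \<forall>x\<in>S_parity R L A a. \<forall>y\<in>S_parity R L A a. c x y = 0) \<and>
     (\<forall>a\<in>{0,1}. \<forall>b\<in>{0,1}. \<forall>x\<in>S_parity R L A a. \<forall>y\<in>S_parity R L A b.
        c x y = - ((-1) ^ (a * b)) * c y x) \<and>
     (\<forall>a\<in>{0,1}. \<forall>b\<in>{0,1}. \<forall>d\<in>{0,1}.
        \<forall>x\<in>S_parity R L A a. \<forall>y\<in>S_parity R L A b. \<forall>z\<in>S_parity R L A d.
          (-1) ^ (a * d) * c x (S_bracket R y z) +
          (-1) ^ (b * a) * c y (S_bracket R z x) +
          (-1) ^ (d * b) * c z (S_bracket R x y) = 0)"

definition is_coboundary ::
  "('a, 'i) surface \<Rightarrow> ('a, 'i) trans_funs \<Rightarrow> 'a set \<Rightarrow>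
     (('a, 'i) selem \<Rightarrow> ('a, 'i) selem \<Rightarrow> complex) \<Rightarrow> bool" where
  "is_coboundary R L A c \<longleftrightarrow>
     (\<exists>k. S_linear R L A k \<and>
        (\<forall>x\<in>S_space R L A. \<forall>y\<in>S_space R L A. c x y = k (S_bracket R x y)))"


section \<open>Separating cycles and the Krichever-Novikov pairing\<close>

text \<open>
  Cycles are singular \<open>1\<close>-chains. A singular \<open>1\<close>-simplex is read as a path on \<open>[0,1]\<close> through the
  parametrisation of the standard simplex running from vertex \<open>0\<close> to vertex \<open>1\<close>.
\<close>

definition simplex_path :: "((nat \<Rightarrow> real) \<Rightarrow> 'a) \<Rightarrow> real \<Rightarrow> 'a" where
  "simplex_path \<sigma> t = \<sigma> (\<lambda>i. if i = 0 then 1 - t else if i = 1 then t else 0)"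

text \<open>In each chart the path has derivatives \<open>D k\<close> of all orders (one-sided at the ends).\<close>

definition smooth_in :: "('a, 'i) surface \<Rightarrow> (real \<Rightarrow> 'a) \<Rightarrow> bool" where
  "smooth_in R \<gamma> \<longleftrightarrow>
     (\<forall>\<alpha>\<in>charts R. \<exists>D :: nat \<Rightarrow> real \<Rightarrow> complex. D 0 = coord R \<alpha> \<circ> \<gamma> \<and>
        (\<forall>k. \<forall>t\<in>{0..1}. \<gamma> t \<in> patch R \<alpha> \<longrightarrow>
           (D k has_vector_derivative D (Suc k) t) (at t within {0..1})))"

definition circle_simplex ::
  "('a, 'i) surface \<Rightarrow> 'i \<Rightarrow> real \<Rightarrow> (nat \<Rightarrow> real) \<Rightarrow> 'a" where
  "circle_simplex R \<alpha> \<epsilon> =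
     restrict (\<lambda>x. chart_inv R \<alpha> (of_real \<epsilon> * cis (2 * pi * x 1))) (standard_simplex 1)"

text \<open>The index of \<open>z\<^sub>p\<close> is \<open>zeta p\<close>; a circle is small if the closed disc it bounds lies in the
  coordinate patch and contains no point of \<open>A\<close> but its centre.\<close>

definition local_coordinate :: "('a, 'i) surface \<Rightarrow> 'i \<Rightarrow> 'a \<Rightarrow> bool" where
  "local_coordinate R \<alpha> x \<longleftrightarrow> \<alpha> \<in> charts R \<and> x \<in> patch R \<alpha> \<and> coord R \<alpha> x = 0"

definition small_radius :: "('a, 'i) surface \<Rightarrow> 'a set \<Rightarrow> 'i \<Rightarrow> real \<Rightarrow> bool" where
  "small_radius R A \<alpha> \<epsilon> \<longleftrightarrow> 0 < \<epsilon> \<and> cball 0 \<epsilon> \<subseteq> coord R \<alpha> ` patch R \<alpha> \<and>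
     (\<forall>w\<in>cball 0 \<epsilon> - {0}. chart_inv R \<alpha> w \<notin> A)"

definition separating_cycle ::
  "('a, 'i) surface \<Rightarrow> 'a set \<Rightarrow> nat \<Rightarrow> (nat \<Rightarrow> 'i) \<Rightarrow> 'a chain \<Rightarrow> bool" where
  "separating_cycle R A K zeta C \<longleftrightarrow>
     singular_relcycle 1 (subtopology (base R) (topspace (base R) - A)) {} C \<and>
     (\<forall>\<sigma>\<in>Poly_Mapping.keys C. smooth_in R (simplex_path \<sigma>)) \<and>
     (\<exists>\<epsilon>. (\<forall>i\<in>{1..K}. small_radius R A (zeta i) (\<epsilon> i)) \<and>
        homologous_rel 1 (subtopology (base R) (topspace (base R) - A)) {} C
          (\<Sum>i\<in>{1..K}. frag_of (circle_simplex R (zeta i) (\<epsilon> i))))"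

text \<open>
  Integration of a \<open>1\<close>-form along a path: at each parameter the integrand is computed in an
  arbitrary chart around the current point; by the transformation law of \<open>1\<close>-forms the choice
  is immaterial.
\<close>

definition path_form_integral :: "('a, 'i) surface \<Rightarrow> (real \<Rightarrow> 'a) \<Rightarrow> ('a, 'i) sect \<Rightarrow> complex" where
  "path_form_integral R \<gamma> \<omega> = integral {0..1} (\<lambda>t.
     let \<alpha> = (SOME \<alpha>. \<alpha> \<in> charts R \<and> \<gamma> t \<in> patch R \<alpha>)
     in \<omega> \<alpha> (\<gamma> t) * vector_derivative (coord R \<alpha> \<circ> \<gamma>) (at t within {0..1}))"

definition chain_form_integral :: "('a, 'i) surface \<Rightarrow> 'a chain \<Rightarrow> ('a, 'i) sect \<Rightarrow> complex" where
  "chain_form_integral R C \<omega> =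
     (\<Sum>\<sigma>\<in>Poly_Mapping.keys C.
        of_int (Poly_Mapping.lookup C \<sigma>) * path_form_integral R (simplex_path \<sigma>) \<omega>)"

definition kn_pairing ::
  "('a, 'i) surface \<Rightarrow> 'a chain \<Rightarrow> ('a, 'i) sect \<Rightarrow> ('a, 'i) sect \<Rightarrow> complex" where
  "kn_pairing R C f g = 1 / (2 * of_real pi * \<i>) * chain_form_integral R C (sect_mult f g)"


section \<open>Krichever-Novikov bases and bounded cocycles\<close>

definition J_index :: "real \<Rightarrow> real set" where
  "J_index lam = (if lam \<in> \<int> then \<int> else {n. n - 1 / 2 \<in> \<int>})"

text \<open>The family \<open>f lam n p\<close> is only relevant for the four weights needed below.\<close>

definition kn_weights :: "real set" where
  "kn_weights = {-1, -1/2, 3/2, 2}"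

definition is_basis_of ::
  "('k \<Rightarrow> ('a, 'i) sect) \<Rightarrow> 'k set \<Rightarrow> ('a, 'i) sect set \<Rightarrow> bool" where
  "is_basis_of b N V \<longleftrightarrow> inj_on b N \<and> \<not> module.dependent sect_scale (b ` N) \<and>
     module.span sect_scale (b ` N) = V"

definition kn_bases ::
  "('a, 'i) surface \<Rightarrow> ('a, 'i) trans_funs \<Rightarrow> nat \<Rightarrow> (nat \<Rightarrow> 'a) \<Rightarrow> nat \<Rightarrow> (nat \<Rightarrow> 'a) \<Rightarrow>
     (nat \<Rightarrow> 'i) \<Rightarrow> 'a chain \<Rightarrow> (real \<Rightarrow> real \<Rightarrow> nat \<Rightarrow> ('a, 'i) sect) \<Rightarrow> bool" where
  "kn_bases R L K P M Q zeta C f \<longleftrightarrow>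
     (\<forall>lam\<in>kn_weights.
        is_basis_of (\<lambda>(n, p). f lam n p) (J_index lam \<times> {1..K})
          (F_space R L (P ` {1..K} \<union> Q ` {1..M}) lam)) \<and>
     (\<forall>lam\<in>kn_weights. \<forall>n\<in>J_index lam. \<forall>p\<in>{1..K}.
        (\<forall>i\<in>{1..K}. \<forall>\<alpha>\<in>charts R. P i \<in> patch R \<alpha> \<longrightarrow>
           ereal ((n + 1 - lam) - of_bool (i = p)) \<le> sect_ord R \<alpha> (f lam n p) (P i)) \<and>
        (\<lambda>w. local_rep R (zeta p) (f lam n p) w / w powi \<lfloor>n - lam\<rfloor> - 1) \<in> O[at 0](\<lambda>w. w)) \<and>
     (\<forall>lam\<in>kn_weights. \<forall>n\<in>J_index lam. \<forall>m\<in>J_index lam. \<forall>p\<in>{1..K}. \<forall>r\<in>{1..K}.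
        kn_pairing R C (f lam n p) (f (1 - lam) (- m) r) = of_bool (p = r \<and> n = m)) \<and>
     (\<exists>a B. (\<forall>j\<in>{1..M}. 0 < a j) \<and> (\<Sum>j\<in>{1..M}. a j) = real K \<and>
        (\<forall>lam\<in>kn_weights. \<forall>n\<in>J_index lam. \<forall>p\<in>{1..K}. \<forall>j\<in>{1..M}. \<forall>\<alpha>\<in>charts R.
           Q j \<in> patch R \<alpha> \<longrightarrow> ereal (- a j * n - B) \<le> sect_ord R \<alpha> (f lam n p) (Q j)))"

definition F_degree ::
  "nat \<Rightarrow> (real \<Rightarrow> real \<Rightarrow> nat \<Rightarrow> ('a, 'i) sect) \<Rightarrow> real \<Rightarrow> real \<Rightarrow> ('a, 'i) sect set" where
  "F_degree K f lam n = module.span sect_scale {f lam n p | p. p \<in> {1..K}}"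

definition half_ints :: "real set" where
  "half_ints = {n. 2 * n \<in> \<int>}"

definition S_degree ::
  "nat \<Rightarrow> (real \<Rightarrow> real \<Rightarrow> nat \<Rightarrow> ('a, 'i) sect) \<Rightarrow> real \<Rightarrow> ('a, 'i) selem set" where
  "S_degree K f n =
     (if n \<in> \<int> then F_degree K f (-1) n \<times> {0} else {0} \<times> F_degree K f (-1/2) n)"

definition bounded_cocycle ::
  "nat \<Rightarrow> (real \<Rightarrow> real \<Rightarrow> nat \<Rightarrow> ('a, 'i) sect) \<Rightarrow>
     (('a, 'i) selem \<Rightarrow> ('a, 'i) selem \<Rightarrow> complex) \<Rightarrow> bool" where
  "bounded_cocycle K f c \<longleftrightarrow>
     (\<exists>M2 :: int. \<forall>n\<in>half_ints. \<forall>m\<in>half_ints.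
        (\<exists>x\<in>S_degree K f n. \<exists>y\<in>S_degree K f m. c x y \<noteq> 0) \<longrightarrow> n + m \<le> of_int M2)"

end

theory Submission
  imports Defs
begin

text \<open>
  An odd cocycle \<open>c\<close> is determined by the values \<open>\<gamma> e \<phi> = c (e, \<phi>)\<close> with \<open>e\<close> a vector field and \<open>\<phi>\<close> a
  \<open>(-1/2)\<close>-form, and for these the cocycle condition on two vector fields and one form reads
  \<open>\<gamma> [e, f] \<phi> = \<gamma> e (f.\<phi>) - \<gamma> f (e.\<phi>)\<close>. In other words, \<open>\<gamma>\<close> is a \<open>1\<close>-cocycle of the Lie algebra of vector
  fields with values in the dual of the space of \<open>(-1/2)\<close>-forms. The claim is that such a cocycle, if
  bounded, is \<open>\<gamma> e \<phi> = \<kappa> (e.\<phi>)\<close> for a linear form \<open>\<kappa>\<close>.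

  The proof looks only at Laurent expansions at the in-points \<open>P\<^sub>i\<close>. Filter both spaces by the minimal
  order at the in-points. The normalisation of the Krichever-Novikov basis elements implies that the
  elements of order at least \<open>N\<close> are exactly the combinations of basis elements of order at least
  \<open>N\<close>. Hence boundedness means that \<open>\<gamma> e \<phi>\<close> vanishes as soon as the orders of \<open>e\<close> and \<open>\<phi>\<close> add up to
  a sufficiently large number.

  The sum \<open>E\<close> of the vector fields of degree \<open>0\<close> in the basis is \<open>z\<^sub>i d/dz\<^sub>i\<close> up to higher order at
  every in-point. So on elements of order \<open>a\<close>, up to elements of higher order, bracketing a
  vector field with \<open>E\<close> is multiplication by \<open>a - 1\<close>, and letting \<open>E\<close> act on a \<open>(-1/2)\<close>-form of order \<open>b\<close>
  is multiplication by \<open>b - 1/2\<close>. As \<open>b - 1/2\<close> is never zero, there is a linear form \<open>\<kappa>\<close> with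
  \<open>\<kappa> (E.\<phi>) = \<gamma> E \<phi>\<close> for all \<open>\<phi>\<close> that vanishes in high orders. After subtracting its coboundary,
  \<open>\<gamma>\<close> is still bounded and satisfies \<open>\<gamma> [E, f] \<phi> + \<gamma> f (E.\<phi>) = 0\<close>. In orders \<open>a\<close> and \<open>b\<close> this says
  that \<open>(a + b - 3/2) * \<gamma> f \<phi>\<close> is a sum of values in higher total order. As \<open>a + b\<close> is an
  integer, descending induction on it shows that \<open>\<gamma>\<close> vanishes.

  This linear algebra is carried out for abstract coefficient functionals in the locales
  \<open>leading_basis\<close> and \<open>semisimple_leading_action\<close>. The geometric input is that the Lie derivative of a
  section along a vector field is again a section and that it commutes with Laurent expansion.
\<close>

section \<open>Bases adapted to the order at finitely many points\<close>

text \<open>An abstract model of a space \<open>W\<close> of sections with finitely many marked points \<open>I\<close>: the number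
\<open>co i j s\<close> stands for the \<open>j\<close>-th Laurent coefficient of \<open>s\<close> at the point \<open>i\<close>, and \<open>g n p\<close> is a
basis element that agrees with \<open>z\<^sub>p\<^sup>n\<close> at \<open>p\<close>, and with \<open>0\<close> at the other points, up to and including
the coefficient of index \<open>n\<close>. The scalars form an arbitrary field.\<close>

locale leading_basis = vector_space scale
  for scale :: "'k::field \<Rightarrow> 'v::ab_group_add \<Rightarrow> 'v" (infixr \<open>\<star>\<close> 75) +
  fixes I :: "'q set" and co :: "'q \<Rightarrow> int \<Rightarrow> 'v \<Rightarrow> 'k" and W :: "'v set"
    and g :: "int \<Rightarrow> 'q \<Rightarrow> 'v"
  assumes finite_I: "finite I"
    and W_eq: "W = span {g n p | n p. p \<in> I}"
    and co_add: "\<lbrakk>x \<in> W; y \<in> W; i \<in> I\<rbrakk> \<Longrightarrow> co i j (x + y) = co i j x + co i j y"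
    and co_scale: "\<lbrakk>x \<in> W; i \<in> I\<rbrakk> \<Longrightarrow> co i j (a \<star> x) = a * co i j x"
    and co_low: "\<lbrakk>p \<in> I; i \<in> I; j < n\<rbrakk> \<Longrightarrow> co i j (g n p) = 0"
    and co_lead: "\<lbrakk>p \<in> I; i \<in> I\<rbrakk> \<Longrightarrow> co i n (g n p) = of_bool (i = p)"
begin

definition fil :: "int \<Rightarrow> 'v set" where
  "fil N = {s \<in> W. \<forall>i\<in>I. \<forall>j<N. co i j s = 0}"

lemma subspace_W: "subspace W"
  by (simp add: W_eq)

lemma W_closed: "x \<in> W \<Longrightarrow> y \<in> W \<Longrightarrow> x + y \<in> W" "x \<in> W \<Longrightarrow> a \<star> x \<in> W"
  "x \<in> W \<Longrightarrow> y \<in> W \<Longrightarrow> x - y \<in> W" "x \<in> W \<Longrightarrow> - x \<in> W" "0 \<in> W"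
  using subspace_W
  by (auto simp: subspace_add subspace_scale subspace_diff subspace_neg subspace_0)

lemma g_in_W: "p \<in> I \<Longrightarrow> g n p \<in> W"
  unfolding W_eq by (rule span_base) blast

lemma co_zero: "i \<in> I \<Longrightarrow> co i j 0 = 0"
  using co_scale[of 0 i j 0] by (simp add: W_closed)

lemma co_diff: "\<lbrakk>x \<in> W; y \<in> W; i \<in> I\<rbrakk> \<Longrightarrow> co i j (x - y) = co i j x - co i j y"
  using co_add[of x "(-1) \<star> y" i j] co_scale[of y i j "-1"] by (simp add: W_closed)

lemma co_sum:
  assumes "i \<in> I" "\<And>x. x \<in> t \<Longrightarrow> v x \<in> W"
  shows "co i j (\<Sum>x\<in>t. u x \<star> v x) = (\<Sum>x\<in>t. u x * co i j (v x))"
proof -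
  have "(\<Sum>x\<in>t. u x \<star> v x) \<in> W \<and> co i j (\<Sum>x\<in>t. u x \<star> v x) = (\<Sum>x\<in>t. u x * co i j (v x))"
    using assms(2) by (induction t rule: infinite_finite_induct)
      (auto simp: assms(1) co_zero W_closed co_add co_scale)
  then show ?thesis by blast
qed

lemma fil_W: "s \<in> fil N \<Longrightarrow> s \<in> W"
  by (simp add: fil_def)

lemma subspace_fil: "subspace (fil N)"
  by (rule subspaceI) (auto simp: fil_def W_closed co_add co_scale co_zero)

lemma g_in_fil: "p \<in> I \<Longrightarrow> N \<le> n \<Longrightarrow> g n p \<in> fil N"
  by (simp add: fil_def g_in_W co_low)

lemma fil_mono: "M \<le> N \<Longrightarrow> fil N \<subseteq> fil M"
  by (auto simp: fil_def)

lemma fil_Suc: "s \<in> fil (N + 1) \<longleftrightarrow> s \<in> fil N \<and> (\<forall>i\<in>I. co i N s = 0)"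
proof -
  have "j < N + 1 \<longleftrightarrow> j < N \<or> j = N" for j :: int by auto
  then show ?thesis by (auto simp: fil_def)
qed

text \<open>This span turns out to consist of exactly the elements of order at least \<open>m\<close> at every marked
point; as a span it is accessible to induction over linear combinations.\<close>

abbreviation tail :: "int \<Rightarrow> 'v set" where
  "tail m \<equiv> span {g n p | n p. m \<le> n \<and> p \<in> I}"

lemma g_in_tail: "m \<le> n \<Longrightarrow> p \<in> I \<Longrightarrow> g n p \<in> tail m"
  by (rule span_base) blast

lemma tail_mono: "m \<le> n \<Longrightarrow> s \<in> tail n \<Longrightarrow> s \<in> tail m"
  by (erule subsetD[OF span_mono, rotated]) (blast intro: order_trans)

text \<open>Because the leading coefficients of the \<open>g m p\<close> form an identity matrix, the coefficients of index
\<open>m\<close> of an element of order at least \<open>m\<close> tell which combination of them to subtract in order to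
raise the order by one.\<close>

lemma lead_step:
  assumes "s \<in> tail m"
  shows "s \<in> W \<and> s - (\<Sum>p\<in>I. co p m s \<star> g m p) \<in> tail (m + 1)"
  using assms
proof (induction rule: span_induct_alt)
  case base
  then show ?case by (simp add: W_closed co_zero span_zero)
next
  case (step a x y)
  then obtain n q where x: "x = g n q" "m \<le> n" "q \<in> I" by blast
  have xW: "x \<in> W" using x by (simp add: g_in_W)
  have "x - (\<Sum>p\<in>I. co p m x \<star> g m p) \<in> tail (m + 1)" (is "?dx \<in> ?S")
  proof (cases "n = m")
    case True
    have "(\<Sum>p\<in>I. co p m x \<star> g m p) = (\<Sum>p\<in>I. if p = q then g m p else 0)"
      using x True by (intro sum.cong) (auto simp: co_lead)
    also have "\<dots> = x" using x True finite_I by simp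
    finally show ?thesis by (simp add: span_zero)
  next
    case False
    then have "(\<Sum>p\<in>I. co p m x \<star> g m p) = 0"
      using x by (intro sum.neutral) (auto simp: co_low)
    moreover have "x \<in> ?S" using x False by (simp add: g_in_tail)
    ultimately show ?thesis by simp
  qed
  moreover have *: "a \<star> x + y - (\<Sum>p\<in>I. co p m (a \<star> x + y) \<star> g m p) =
      a \<star> ?dx + (y - (\<Sum>p\<in>I. co p m y \<star> g m p))"
    using step.IH xW
    by (simp add: co_add co_scale W_closed scale_left_distrib sum.distrib scale_right_diff_distrib
        scale_sum_right)
  ultimately show ?case
    using step.IH xW unfolding * by (simp add: W_closed span_add span_scale)
qed

lemma span_bounded_below:
  assumes "s \<in> W"
  obtains m where "s \<in> tail m"
proof -
  have "\<exists>m. s \<in> tail m"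
    using assms unfolding W_eq
  proof (induction rule: span_induct_alt)
    case base
    then show ?case by (simp add: span_zero)
  next
    case (step a x y)
    then obtain n q m where x: "x = g n q" "q \<in> I"
      and y: "y \<in> tail m" by blast
    have "x \<in> tail (min n m)"
      using x by (simp add: g_in_tail)
    moreover have "y \<in> tail (min n m)"
      by (rule tail_mono[OF _ y]) simp
    ultimately show ?case by (blast intro: span_add span_scale)
  qed
  then show thesis using that by blast
qed

text \<open>The order of a finite linear combination is the smallest index occurring in it: leading terms of
the same index cannot cancel. This is what translates degrees in the almost-grading into orders at
the marked points.\<close>

lemma fil_eq_span: "fil N = tail N"
proof (intro equalityI subsetI)
  fix s assume s: "s \<in> tail N"
  have "{g n p | n p. N \<le> n \<and> p \<in> I} \<subseteq> fil N"
    by (auto simp: g_in_fil)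
  from span_minimal[OF this subspace_fil] s show "s \<in> fil N" by blast
next
  fix s assume s: "s \<in> fil N"
  then obtain m where m: "s \<in> tail m"
    using span_bounded_below fil_W by blast
  have *: "s \<in> tail (m + int k)" if "m + int k \<le> N" for k
    using that
  proof (induction k)
    case 0
    then show ?case using m by simp
  next
    case (Suc k)
    have "(\<Sum>p\<in>I. co p (m + int k) s \<star> g (m + int k) p) = 0"
      using s Suc.prems by (intro sum.neutral) (auto simp: fil_def)
    with lead_step[OF Suc.IH] Suc.prems show ?case by (simp add: ac_simps)
  qed
  show "s \<in> tail N"
  proof (cases "m \<le> N")
    case True
    then show ?thesis using *[of "nat (N - m)"] by simp
  next
    case False
    then show ?thesis by (intro tail_mono[OF _ m]) simp
  qed
qed

lemma zero_on_fil:
  assumes add: "\<And>x y. \<lbrakk>x \<in> W; y \<in> W\<rbrakk> \<Longrightarrow> l (x + y) = l x + (l y :: 'k)"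
    and scale: "\<And>a x. x \<in> W \<Longrightarrow> l (a \<star> x) = a * l x"
    and gen: "\<And>n p. \<lbrakk>N \<le> n; p \<in> I\<rbrakk> \<Longrightarrow> l (g n p) = 0"
    and s: "s \<in> fil N"
  shows "l s = 0"
proof -
  have "s \<in> W \<and> l s = 0"
    using s unfolding fil_eq_span
  proof (induction rule: span_induct_alt)
    case base
    show ?case using scale[of 0 0] by (simp add: W_closed)
  next
    case (step a x y)
    then have "x \<in> W" "l x = 0" using g_in_W gen by blast+
    then show ?case using step.IH by (simp add: W_closed add scale)
  qed
  then show ?thesis by simp
qed

lemma fil_exhausts:
  assumes "s \<in> W" obtains N where "s \<in> fil N"
  using span_bounded_below[OF assms] fil_eq_span by blast

text \<open>In a vanishing linear combination of the \<open>h n p\<close>, a term of smallest index \<open>n\<close> would be the only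
one to contribute to the coefficient of index \<open>n\<close> at \<open>p\<close>. This applies in particular to the images of
the basis under an operator that acts on leading coefficients by nonzero scalars.\<close>

lemma triangular_independent:
  assumes W: "\<And>n p. p \<in> I \<Longrightarrow> h n p \<in> fil n"
    and lead: "\<And>n p i. \<lbrakk>p \<in> I; i \<in> I\<rbrakk> \<Longrightarrow> co i n (h n p) = (if i = p then d n else 0)"
    and d: "\<And>n. d n \<noteq> 0"
  shows "inj_on (\<lambda>(n, p). h n p) (UNIV \<times> I)"
    and "independent ((\<lambda>(n, p). h n p) ` (UNIV \<times> I))"
proof -
  have low: "co i j (h n p) = 0" if "p \<in> I" "i \<in> I" "j < n" for i j n p
    using W[OF that(1), of n] that by (simp add: fil_def)
  have le: "m \<le> n" if "h n p = h m q" "p \<in> I" "q \<in> I" for n m p q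
    using low[of q p n m] lead[of p p n] d[of n] that by force
  have eq: "n = m \<and> p = q" if *: "h n p = h m q" "p \<in> I" "q \<in> I" for n m p q
  proof -
    have "n = m" using le[OF *] le[OF *(1)[symmetric] *(3,2)] by simp
    then show ?thesis using lead[of q p m] lead[of p p n] d[of n] * by (auto split: if_splits)
  qed
  then show inj: "inj_on (\<lambda>(n, p). h n p) (UNIV \<times> I)"
    by (auto simp: inj_on_def)
  show "independent ((\<lambda>(n, p). h n p) ` (UNIV \<times> I))"
    unfolding dependent_explicit
  proof (intro notI, elim exE conjE bexE)
    fix t u v1
    assume t: "finite t" "t \<subseteq> (\<lambda>(n, p). h n p) ` (UNIV \<times> I)" "(\<Sum>v\<in>t. u v \<star> v) = 0"
      and v1: "v1 \<in> t" "u v1 \<noteq> 0"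
    define X where "X = {x \<in> UNIV \<times> I. h (fst x) (snd x) \<in> t \<and> u (h (fst x) (snd x)) \<noteq> 0}"
    have "finite ((\<lambda>(n, p). h n p) ` X)"
      by (rule finite_subset[OF _ t(1)]) (auto simp: X_def)
    then have "finite X"
      by (rule finite_imageD) (rule inj_on_subset[OF inj], auto simp: X_def)
    moreover obtain n1 p1 where "v1 = h n1 p1" "p1 \<in> I" using v1 t(2) by auto
    then have "X \<noteq> {}" using v1 by (auto simp: X_def)
    ultimately have "Min (fst ` X) \<in> fst ` X" and min: "\<And>y. y \<in> X \<Longrightarrow> Min (fst ` X) \<le> fst y"
      by simp_all
    then obtain n p where n: "n = Min (fst ` X)" and x: "p \<in> I" "h n p \<in> t" "u (h n p) \<noteq> 0"
      by (force simp: X_def)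
    have tW: "v \<in> W" if "v \<in> t" for v
      using t(2) that W fil_W by fastforce
    have zero: "u v * co p n v = 0" if "v \<in> t" "v \<noteq> h n p" for v
    proof (rule ccontr)
      assume nz: "u v * co p n v \<noteq> 0"
      from that t(2) obtain m q where v: "v = h m q" "q \<in> I" by auto
      have "(m, q) \<in> X" using that v nz by (auto simp: X_def)
      then have "n \<le> m" using min n by fastforce
      then show False
        using nz v low[of q p n m] lead[of q p m] x that by (cases "n = m") (auto split: if_splits)
    qed
    have "0 = co p n (\<Sum>v\<in>t. u v \<star> v)" using t(3) co_zero x by simp
    also have "\<dots> = (\<Sum>v\<in>t. u v * co p n v)" using co_sum[of p t "\<lambda>v. v"] x tW by simp
    also have "\<dots> = u (h n p) * co p n (h n p)"
    proof -
      have "(\<Sum>v\<in>t - {h n p}. u v * co p n v) = 0"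
        by (rule sum.neutral) (use zero in blast)
      then show ?thesis by (simp add: sum.remove[OF t(1) x(2)])
    qed
    also have "\<dots> \<noteq> 0" using x lead[of p p n] d[of n] by simp
    finally show False by simp
  qed
qed

lemma functional_with_prescribed_values:
  assumes "\<And>n p. p \<in> I \<Longrightarrow> h n p \<in> fil n"
    and "\<And>n p i. \<lbrakk>p \<in> I; i \<in> I\<rbrakk> \<Longrightarrow> co i n (h n p) = (if i = p then d n else 0)"
    and "\<And>n. d n \<noteq> 0"
  obtains \<kappa> where "Vector_Spaces.linear (\<star>) (*) \<kappa>" and "\<And>n p. p \<in> I \<Longrightarrow> \<kappa> (h n p) = v n p"
proof -
  interpret vector_space_pair "(\<star>)" "(*) :: 'k \<Rightarrow> 'k \<Rightarrow> 'k"
    by unfold_locales (auto simp: algebra_simps)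
  let ?H = "\<lambda>(n, p). h n p"
  let ?B = "?H ` (UNIV \<times> I)"
  note tri = triangular_independent[of h d, OF assms]
  define \<kappa> where "\<kappa> = construct ?B (\<lambda>b. case_prod v (inv_into (UNIV \<times> I) ?H b))"
  have val: "\<kappa> (h n p) = v n p" if "p \<in> I" for n p
  proof -
    have "inv_into (UNIV \<times> I) ?H (h n p) = (n, p)"
      using inv_into_f_f[OF tri(1), of "(n, p)"] that by simp
    moreover have "h n p \<in> ?B" using that by (auto simp: image_iff)
    ultimately show ?thesis by (simp add: \<kappa>_def construct_basis[OF tri(2)])
  qed
  have "Vector_Spaces.linear (\<star>) (*) \<kappa>"
    unfolding \<kappa>_def by (rule linear_construct[OF tri(2)])
  from that[OF this val] show thesis .
qed

end

section \<open>Vanishing of cohomology by an Euler element\<close>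

text \<open>Two such spaces, \<open>V\<close> acting on \<open>W\<close> by an operation \<open>act\<close> that respects orders in the way a first
order differential operator does, together with an element \<open>E\<close> of \<open>V\<close> behaving like the Euler field
\<open>z d/dz\<close>: on the graded pieces of \<open>V\<close> and \<open>W\<close> it acts by the scalars \<open>wV a\<close> and \<open>wW b\<close>. The map
\<open>ad\<close> is the bracket with \<open>E\<close>. The module identity for \<open>act\<close> is stated for coefficients, so that it
can be verified on formal Laurent series.

The two non-resonance conditions at the end are what kills the cohomology. In the application
the weights are \<open>a - 1\<close> and \<open>b - 1/2\<close>, so both conditions hold because \<open>1/2\<close> is not an integer.\<close>

locale semisimple_leading_action =
  V: leading_basis scale I co V e + W: leading_basis scale I co W \<phi>
  for scale :: "'k::field \<Rightarrow> 'v::ab_group_add \<Rightarrow> 'v" (infixr \<open>\<star>\<close> 75)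
    and I :: "'q set" and co :: "'q \<Rightarrow> int \<Rightarrow> 'v \<Rightarrow> 'k"
    and V e W \<phi> +
  fixes ad :: "'v \<Rightarrow> 'v" and act :: "'v \<Rightarrow> 'v \<Rightarrow> 'v" and E :: 'v
    and wV wW :: "int \<Rightarrow> 'k"
  assumes E: "E \<in> V.fil 1"
    and ad_fil: "f \<in> V.fil a \<Longrightarrow> ad f \<in> V.fil a"
    and ad_lead: "\<lbrakk>f \<in> V.fil a; i \<in> I\<rbrakk> \<Longrightarrow> co i a (ad f) = wV a * co i a f"
    and act_fil: "\<lbrakk>f \<in> V.fil a; s \<in> W.fil b\<rbrakk> \<Longrightarrow> act f s \<in> W.fil (a + b - 1)"
    and act_lead: "\<lbrakk>s \<in> W.fil b; i \<in> I\<rbrakk> \<Longrightarrow> co i b (act E s) = wW b * co i b s"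
    and act_add: "\<lbrakk>f \<in> V; f' \<in> V; s \<in> W\<rbrakk> \<Longrightarrow> act (f + f') s = act f s + act f' s"
      "\<lbrakk>f \<in> V; s \<in> W; s' \<in> W\<rbrakk> \<Longrightarrow> act f (s + s') = act f s + act f s'"
    and act_scale: "\<lbrakk>f \<in> V; s \<in> W\<rbrakk> \<Longrightarrow> act (r \<star> f) s = r \<star> act f s"
      "\<lbrakk>f \<in> V; s \<in> W\<rbrakk> \<Longrightarrow> act f (r \<star> s) = r \<star> act f s"
    and act_ad: "\<lbrakk>f \<in> V; s \<in> W; i \<in> I\<rbrakk> \<Longrightarrow>
      co i j (act (ad f) s) = co i j (act E (act f s)) - co i j (act f (act E s))"
    and wW_nonzero: "wW b \<noteq> 0"
    and wV_wW_nonzero: "wV a + wW b \<noteq> 0"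
begin

lemma E_V: "E \<in> V"
  using E by (rule V.fil_W)

lemma ad_V: "f \<in> V \<Longrightarrow> ad f \<in> V"
  using V.fil_exhausts ad_fil V.fil_W by metis

lemma act_W: "f \<in> V \<Longrightarrow> s \<in> W \<Longrightarrow> act f s \<in> W"
  using V.fil_exhausts W.fil_exhausts act_fil W.fil_W by metis

lemma act_E_fil: "s \<in> W.fil b \<Longrightarrow> act E s \<in> W.fil b"
  using act_fil[OF E] by simp

text \<open>Descending induction on \<open>a + b\<close>, starting from the bound \<open>N\<close>. On elements of orders \<open>a\<close> and \<open>b\<close> the
cocycle identity reads \<open>(wV a + wW b) * \<gamma> f s = 0\<close> up to values of \<open>\<gamma>\<close> at arguments of larger
total order, which vanish by induction.\<close>

lemma cocycle_zero_if_zero_at_E: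
  assumes add: "\<And>f f' s. \<lbrakk>f \<in> V; f' \<in> V; s \<in> W\<rbrakk> \<Longrightarrow> \<gamma> (f + f') s = \<gamma> f s + \<gamma> f' s"
      "\<And>f s s'. \<lbrakk>f \<in> V; s \<in> W; s' \<in> W\<rbrakk> \<Longrightarrow> \<gamma> f (s + s') = \<gamma> f s + \<gamma> f s'"
    and scale: "\<And>a f s. \<lbrakk>f \<in> V; s \<in> W\<rbrakk> \<Longrightarrow> \<gamma> (a \<star> f) s = a * \<gamma> f s"
      "\<And>a f s. \<lbrakk>f \<in> V; s \<in> W\<rbrakk> \<Longrightarrow> \<gamma> f (a \<star> s) = a * \<gamma> f s"
    and bounded: "\<And>a b f s. \<lbrakk>N \<le> a + b; f \<in> V.fil a; s \<in> W.fil b\<rbrakk> \<Longrightarrow> \<gamma> f s = 0"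
    and cocycle: "\<And>f s. \<lbrakk>f \<in> V; s \<in> W\<rbrakk> \<Longrightarrow> \<gamma> (ad f) s + \<gamma> f (act E s) = 0"
    and "f \<in> V" "s \<in> W"
  shows "\<gamma> f s = (0 :: 'k)"
proof -
  have vanish: "\<gamma> f s = 0" if "N - int t \<le> a + b" "f \<in> V.fil a" "s \<in> W.fil b" for t a b f s
    using that
  proof (induction t arbitrary: a b f s)
    case 0
    then show ?case using bounded by simp
  next
    case (Suc t)
    have fV: "f \<in> V" and sW: "s \<in> W" using Suc.prems V.fil_W W.fil_W by auto
    define f' where "f' = ad f - wV a \<star> f"
    define s' where "s' = act E s - wW b \<star> s"
    have f': "f' \<in> V.fil (a + 1)"
      unfolding f'_def V.fil_Suc using Suc.prems fV ad_fil ad_V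
      by (auto simp: V.co_diff V.co_scale ad_lead V.W_closed
          intro!: V.subspace_diff[OF V.subspace_fil] V.subspace_scale[OF V.subspace_fil])
    have s': "s' \<in> W.fil (b + 1)"
      unfolding s'_def W.fil_Suc using Suc.prems sW act_E_fil act_W E_V
      by (auto simp: W.co_diff W.co_scale act_lead W.W_closed
          intro!: V.subspace_diff[OF W.subspace_fil] V.subspace_scale[OF W.subspace_fil])
    have "\<gamma> f' s = 0" "\<gamma> f s' = 0"
      using Suc.IH[OF _ f' Suc.prems(3)] Suc.IH[OF _ Suc.prems(2) s'] Suc.prems(1) by auto
    moreover have "ad f = wV a \<star> f + f'" "act E s = wW b \<star> s + s'"
      by (simp_all add: f'_def s'_def)
    ultimately have "(wV a + wW b) * \<gamma> f s = \<gamma> (ad f) s + \<gamma> f (act E s)"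
      using fV sW V.fil_W[OF f'] W.fil_W[OF s']
      by (simp add: add scale V.W_closed W.W_closed distrib_right)
    then show ?case using cocycle[OF fV sW] wV_wW_nonzero[of a b] by simp
  qed
  obtain a b where ab: "f \<in> V.fil a" "s \<in> W.fil b"
    using assms(7,8) V.fil_exhausts W.fil_exhausts by metis
  have "N - int (nat (N - (a + b))) \<le> a + b" by simp
  from vanish[OF this ab] show ?thesis .
qed

text \<open>The functional \<open>\<kappa>\<close> is forced to satisfy \<open>\<kappa> (act E s) = \<gamma> E s\<close>. As \<open>E\<close> acts on \<open>W\<close> by an upper
triangular operator with nonzero diagonal, this requirement can be met, and together with
vanishing in high orders. Then \<open>\<gamma>\<close> minus the coboundary of \<open>\<kappa>\<close> is again a bounded cocycle, and it
vanishes at \<open>E\<close>.\<close>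

theorem bounded_cocycle_is_coboundary:
  assumes add: "\<And>f f' s. \<lbrakk>f \<in> V; f' \<in> V; s \<in> W\<rbrakk> \<Longrightarrow> \<gamma> (f + f') s = \<gamma> f s + \<gamma> f' s"
      "\<And>f s s'. \<lbrakk>f \<in> V; s \<in> W; s' \<in> W\<rbrakk> \<Longrightarrow> \<gamma> f (s + s') = \<gamma> f s + \<gamma> f s'"
    and scale: "\<And>a f s. \<lbrakk>f \<in> V; s \<in> W\<rbrakk> \<Longrightarrow> \<gamma> (a \<star> f) s = a * \<gamma> f s"
      "\<And>a f s. \<lbrakk>f \<in> V; s \<in> W\<rbrakk> \<Longrightarrow> \<gamma> f (a \<star> s) = a * \<gamma> f s"
    and bounded: "\<And>a b f s. \<lbrakk>N \<le> a + b; f \<in> V.fil a; s \<in> W.fil b\<rbrakk> \<Longrightarrow> \<gamma> f s = 0"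
    and cocycle: "\<And>f s. \<lbrakk>f \<in> V; s \<in> W\<rbrakk> \<Longrightarrow> \<gamma> (ad f) s = \<gamma> E (act f s) - \<gamma> f (act E s)"
  shows "\<exists>\<kappa>. Vector_Spaces.linear (\<star>) (*) \<kappa> \<and> (\<forall>f\<in>V. \<forall>s\<in>W. \<gamma> f s = (\<kappa> (act f s) :: 'k))"
proof -
  \<comment> \<open>The family mixes images under \<open>E\<close> in low orders with basis elements in high orders, so that
    one choice of values prescribes \<open>\<kappa>\<close> on the image of \<open>E\<close> and makes it vanish on elements of
    order at least \<open>N - 1\<close>, where \<open>\<gamma> E\<close> vanishes since \<open>E\<close> has order \<open>1\<close>.\<close>
  define h where "h n p = (if n < N - 1 then act E (\<phi> n p) else \<phi> n p)" for n p
  define v where "v n p = (if n < N - 1 then \<gamma> E (\<phi> n p) else 0)" for n p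
  have h_fil: "h n p \<in> W.fil n" if "p \<in> I" for n p
    using W.g_in_fil[OF that order_refl] act_E_fil by (simp add: h_def)
  have h_lead: "co i n (h n p) = (if i = p then if n < N - 1 then wW n else 1 else 0)"
    if "p \<in> I" "i \<in> I" for n p i
    using act_lead[OF W.g_in_fil[OF that(1) order_refl] that(2), of n] that
    by (auto simp: h_def W.co_lead)
  have "(if n < N - 1 then wW n else 1) \<noteq> 0" for n
    using wW_nonzero by simp
  from W.functional_with_prescribed_values[OF h_fil h_lead this, of v]
  obtain \<kappa> where lin: "Vector_Spaces.linear (\<star>) (*) \<kappa>"
    and val: "\<And>n p. p \<in> I \<Longrightarrow> \<kappa> (h n p) = v n p" by blast
  interpret \<kappa>: Vector_Spaces.linear "(\<star>)" "(*)" \<kappa> by (rule lin)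
  have high: "\<kappa> s = 0" if "s \<in> W.fil (N - 1)" for s
    using that
  proof (rule W.zero_on_fil[rotated 3])
    show "\<kappa> (\<phi> n p) = 0" if "N - 1 \<le> n" "p \<in> I" for n p
      using val[OF that(2), of n] that(1) by (simp add: h_def v_def)
  qed (simp_all add: \<kappa>.add \<kappa>.scale)
  define \<gamma>' where "\<gamma>' f s = \<gamma> f s - \<kappa> (act f s)" for f s
  have gen0: "\<gamma>' E (\<phi> n p) = 0" if p: "p \<in> I" for n p
  proof (cases "n < N - 1")
    case True
    then show ?thesis using val[OF p, of n] by (simp add: \<gamma>'_def h_def v_def)
  next
    case False
    then have "\<phi> n p \<in> W.fil (N - 1)" using p W.g_in_fil by simp
    then show ?thesis
      using bounded[of 1 "N - 1" E "\<phi> n p"] E high[OF act_E_fil] by (simp add: \<gamma>'_def)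
  qed
  have E0: "\<gamma>' E s = 0" if "s \<in> W" for s
  proof -
    obtain b where "s \<in> W.fil b" using W.fil_exhausts \<open>s \<in> W\<close> .
    then show ?thesis
      by (rule W.zero_on_fil[rotated 3])
        (simp_all add: gen0[unfolded \<gamma>'_def] \<gamma>'_def E_V add scale act_add act_scale \<kappa>.add \<kappa>.scale algebra_simps)
  qed
  have "\<gamma>' f s = 0" if "f \<in> V" "s \<in> W" for f s
  proof (rule cocycle_zero_if_zero_at_E[of \<gamma>' N, OF _ _ _ _ _ _ that])
    show "\<gamma>' f s = 0" if "N \<le> a + b" "f \<in> V.fil a" "s \<in> W.fil b" for a b f s
      using bounded[OF that] high act_fil[OF that(2,3)] W.fil_mono[of "N - 1" "a + b - 1"] that(1)
      by (auto simp: \<gamma>'_def)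
  next
    fix f s assume fs: "f \<in> V" "s \<in> W"
    \<comment> \<open>The module identity is known for coefficients only, but \<open>\<kappa>\<close> does not see elements all of whose
      coefficients vanish.\<close>
    let ?j = "act E (act f s) - act f (act E s) - act (ad f) s"
    have "?j \<in> W.fil (N - 1)"
      unfolding W.fil_def using fs
      by (auto simp: act_W E_V ad_V W.W_closed W.co_diff act_ad)
    then have "\<kappa> (act (ad f) s) = \<kappa> (act E (act f s)) - \<kappa> (act f (act E s))"
      using high[of ?j] by (simp add: \<kappa>.diff)
    then show "\<gamma>' (ad f) s + \<gamma>' f (act E s) = 0"
      using E0[of "act f s"] cocycle[OF fs] act_W[OF fs] by (simp add: \<gamma>'_def algebra_simps)
  qed (simp_all add: \<gamma>'_def add scale act_add act_scale \<kappa>.add \<kappa>.scale algebra_simps)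
  then show ?thesis using lin by (auto simp: \<gamma>'_def)
qed

end

section \<open>Lie derivatives of meromorphic sections\<close>

lemma chart_inv_coord:
  assumes "riemann_surface R" "\<alpha> \<in> charts R" "x \<in> patch R \<alpha>"
  shows "chart_inv R \<alpha> (coord R \<alpha> x) = x"
proof -
  have "homeomorphic_map (subtopology (base R) (patch R \<alpha>))
      (top_of_set (coord R \<alpha> ` patch R \<alpha>)) (coord R \<alpha>)" and "openin (base R) (patch R \<alpha>)"
    using assms unfolding riemann_surface_def by blast+
  then have "inj_on (coord R \<alpha>) (patch R \<alpha>)"
    using homeomorphic_imp_injective_map openin_subset[of "base R" "patch R \<alpha>"]
    by (fastforce simp: Int_absorb1)
  then show ?thesis using assms(3) by (simp add: chart_inv_def)
qed

lemma coord_chart_inv: "w \<in> coord R \<alpha> ` patch R \<alpha> \<Longrightarrow> coord R \<alpha> (chart_inv R \<alpha> w) = w"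
  by (simp add: chart_inv_def f_inv_into_f)

lemma open_coord_image:
  assumes "riemann_surface R" "\<alpha> \<in> charts R" "openin (base R) U" "U \<subseteq> patch R \<alpha>"
  shows "open (coord R \<alpha> ` U)"
proof -
  have hom: "homeomorphic_map (subtopology (base R) (patch R \<alpha>))
      (top_of_set (coord R \<alpha> ` patch R \<alpha>)) (coord R \<alpha>)" and op: "open (coord R \<alpha> ` patch R \<alpha>)"
    using assms unfolding riemann_surface_def by blast+
  have "openin (subtopology (base R) (patch R \<alpha>)) U"
    using assms(3,4) by (auto simp: openin_subtopology)
  then have "openin (top_of_set (coord R \<alpha> ` patch R \<alpha>)) (coord R \<alpha> ` U)"
    using homeomorphic_imp_open_map[OF hom] by (auto simp: open_map_def)
  then show ?thesis using op openin_open_trans by blast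
qed

lemma openin_patch: "riemann_surface R \<Longrightarrow> \<alpha> \<in> charts R \<Longrightarrow> openin (base R) (patch R \<alpha>)"
  unfolding riemann_surface_def by blast

lemma open_coord_image_minus_finite:
  assumes "riemann_surface R" "\<alpha> \<in> charts R" "openin (base R) U" "U \<subseteq> patch R \<alpha>" "finite A"
  shows "open (coord R \<alpha> ` (U - A))"
proof -
  have "inj_on (coord R \<alpha>) (patch R \<alpha>)"
    using chart_inv_coord[OF assms(1,2)] by (metis inj_onI)
  then have "coord R \<alpha> ` (U - A) = coord R \<alpha> ` U - coord R \<alpha> ` (A \<inter> U)"
    using assms(4) by (auto simp: inj_on_def)
  moreover have "closed (coord R \<alpha> ` (A \<inter> U))"
    using assms(5) by (intro finite_imp_closed) auto
  ultimately show ?thesis using open_coord_image[OF assms(1-4)] by (simp add: open_Diff)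
qed

text \<open>The Lie derivative of forms of weight \<open>k / 2\<close> along the vector field \<open>e\<close>, in local coordinates.
It covers both the bracket of vector fields, which are forms of weight \<open>-1\<close>, and their action on
forms of weight \<open>-1/2\<close>.\<close>

definition lie_derivative ::
  "('a, 'i) surface \<Rightarrow> int \<Rightarrow> ('a, 'i) sect \<Rightarrow> ('a, 'i) sect \<Rightarrow> ('a, 'i) sect" where
  "lie_derivative R k e s =
     (\<lambda>\<alpha> x. e \<alpha> x * sect_deriv R s \<alpha> x + of_int k / 2 * s \<alpha> x * sect_deriv R e \<alpha> x)"

lemma vf_bracket_eq: "vf_bracket R = lie_derivative R (-2)"
  by (simp add: vf_bracket_def lie_derivative_def fun_eq_iff)

lemma vf_action_eq: "vf_action R = lie_derivative R (-1)"
  by (simp add: vf_action_def lie_derivative_def fun_eq_iff)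

lemma local_rep_lie_derivative:
  assumes "w \<in> coord R \<alpha> ` patch R \<alpha>"
  shows "local_rep R \<alpha> (lie_derivative R k e s) w =
    local_rep R \<alpha> e w * deriv (local_rep R \<alpha> s) w
      + of_int k / 2 * local_rep R \<alpha> s w * deriv (local_rep R \<alpha> e) w"
  using coord_chart_inv[OF assms]
  by (simp add: local_rep_def lie_derivative_def sect_deriv_def)

lemma mero_sectionsD:
  assumes "s \<in> mero_sections R B A"
  shows "\<not> (\<alpha> \<in> charts R \<and> x \<in> patch R \<alpha> - A) \<Longrightarrow> s \<alpha> x = 0"
    and "\<lbrakk>\<alpha> \<in> charts R; \<beta> \<in> charts R; x \<in> (patch R \<alpha> \<inter> patch R \<beta>) - A\<rbrakk> \<Longrightarrow> s \<alpha> x = B \<alpha> \<beta> x * s \<beta> x"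
    and "\<alpha> \<in> charts R \<Longrightarrow> local_rep R \<alpha> s holomorphic_on coord R \<alpha> ` (patch R \<alpha> - A)"
    and "\<alpha> \<in> charts R \<Longrightarrow> local_rep R \<alpha> s meromorphic_on coord R \<alpha> ` patch R \<alpha>"
  using assms unfolding mero_sections_def by blast+

text \<open>The derivative of a section is not a section: the product rule, applied to
\<open>s\<^sub>\<alpha> = L\<^sup>k s\<^sub>\<beta>\<close>, produces a term with the derivative of the transition function. The factor
\<open>L\<^sup>2\<close> in the other term is \<open>dz\<^sub>\<beta> / dz\<^sub>\<alpha>\<close>, by the defining property of a theta characteristic.\<close>

lemma sect_deriv_transform:
  assumes R: "riemann_surface R" and L: "theta_characteristic R L" and "finite A"
    and s: "s \<in> mero_sections R (bundle_power L k) A"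
    and ab: "\<alpha> \<in> charts R" "\<beta> \<in> charts R" and x: "x \<in> (patch R \<alpha> \<inter> patch R \<beta>) - A"
  shows "sect_deriv R s \<alpha> x =
    of_int k * L \<alpha> \<beta> x powi (k - 1) * deriv (L \<alpha> \<beta> \<circ> chart_inv R \<alpha>) (coord R \<alpha> x) * s \<beta> x
      + L \<alpha> \<beta> x powi (k + 2) * sect_deriv R s \<beta> x"
proof -
  let ?D = "patch R \<alpha> \<inter> patch R \<beta>"
  define \<Lambda> where "\<Lambda> = L \<alpha> \<beta> \<circ> chart_inv R \<alpha>"
  define \<tau> where "\<tau> = coord R \<beta> \<circ> chart_inv R \<alpha>"
  define w where "w = coord R \<alpha> x"
  have opD: "openin (base R) ?D" using openin_patch[OF R] ab by blast
  have inv: "chart_inv R \<alpha> w = x" "\<Lambda> w = L \<alpha> \<beta> x" "\<tau> w = coord R \<beta> x"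
    using chart_inv_coord[OF R ab(1)] x by (auto simp: w_def \<Lambda>_def \<tau>_def)
  have nz: "\<Lambda> w \<noteq> 0"
    using L x ab inv(2) unfolding theta_characteristic_def line_bundle_def by auto
  have w: "w \<in> coord R \<alpha> ` ?D" using x by (auto simp: w_def)
  have opW: "open (coord R \<alpha> ` ?D)" using open_coord_image[OF R ab(1) opD] by blast
  have "\<Lambda> holomorphic_on coord R \<alpha> ` ?D" "\<tau> holomorphic_on coord R \<alpha> ` ?D"
    using L R ab unfolding theta_characteristic_def line_bundle_def riemann_surface_def \<Lambda>_def \<tau>_def
    by blast+
  then have d\<Lambda>: "(\<Lambda> has_field_derivative deriv \<Lambda> w) (at w)"
    and d\<tau>: "(\<tau> has_field_derivative deriv \<tau> w) (at w)"
    using holomorphic_derivI opW w by blast+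
  have "deriv \<tau> w = \<Lambda> w ^ 2"
    using L ab x inv unfolding theta_characteristic_def canonical_bundle_def bundle_power_def \<tau>_def w_def
    by (auto simp: power_int_def)
  with d\<tau> have d\<tau>: "(\<tau> has_field_derivative \<Lambda> w ^ 2) (at w)" by simp
  have "(local_rep R \<beta> s has_field_derivative sect_deriv R s \<beta> x) (at (\<tau> w))"
    unfolding inv(3) sect_deriv_def
    using open_coord_image_minus_finite[OF R ab(2) openin_patch[OF R ab(2)] order_refl \<open>finite A\<close>]
      mero_sectionsD(3)[OF s ab(2)] x by (intro holomorphic_derivI) auto
  then have ds: "((\<lambda>v. local_rep R \<beta> s (\<tau> v)) has_field_derivative sect_deriv R s \<beta> x * \<Lambda> w ^ 2) (at w)"
    using DERIV_chain2[OF _ d\<tau>] by blast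
  have s_tau: "local_rep R \<beta> s (\<tau> w) = s \<beta> x"
    using x chart_inv_coord[OF R ab(2)] by (simp add: local_rep_def inv)
  have der: "((\<lambda>v. \<Lambda> v powi k * local_rep R \<beta> s (\<tau> v)) has_field_derivative
      of_int k * \<Lambda> w powi (k - 1) * deriv \<Lambda> w * s \<beta> x
        + \<Lambda> w powi k * (sect_deriv R s \<beta> x * \<Lambda> w ^ 2)) (at w)"
    using DERIV_mult[OF DERIV_power_int[OF d\<Lambda> disjI2[OF nz], of k] ds] s_tau
    by (simp add: algebra_simps)
  have eq: "\<Lambda> v powi k * local_rep R \<beta> s (\<tau> v) = local_rep R \<alpha> s v"
    if v: "v \<in> coord R \<alpha> ` (?D - A)" for v
  proof -
    obtain y where y: "y \<in> ?D - A" "v = coord R \<alpha> y" using v by blast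
    then have "chart_inv R \<alpha> v = y" "chart_inv R \<beta> (coord R \<beta> y) = y"
      using chart_inv_coord[OF R ab(1)] chart_inv_coord[OF R ab(2)] by auto
    then show ?thesis
      using mero_sectionsD(2)[OF s ab, of y] y
      by (simp add: local_rep_def \<Lambda>_def \<tau>_def bundle_power_def)
  qed
  have opU: "open (coord R \<alpha> ` (?D - A))" and wU: "w \<in> coord R \<alpha> ` (?D - A)"
    using open_coord_image_minus_finite[OF R ab(1) opD _ \<open>finite A\<close>] x by (auto simp: w_def)
  from has_field_derivative_transform_within_open[OF der opU wU eq]
  have "(local_rep R \<alpha> s has_field_derivative
      of_int k * \<Lambda> w powi (k - 1) * deriv \<Lambda> w * s \<beta> x
        + \<Lambda> w powi k * (sect_deriv R s \<beta> x * \<Lambda> w ^ 2)) (at w)"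
    .
  then have "sect_deriv R s \<alpha> x = of_int k * \<Lambda> w powi (k - 1) * deriv \<Lambda> w * s \<beta> x
        + \<Lambda> w powi k * (sect_deriv R s \<beta> x * \<Lambda> w ^ 2)"
    unfolding sect_deriv_def w_def[symmetric] by (rule DERIV_imp_deriv)
  moreover have "\<Lambda> w powi (k + 2) = \<Lambda> w powi k * \<Lambda> w ^ 2"
    using nz by (simp add: power_int_add)
  ultimately show ?thesis
    by (simp add: inv(2) \<Lambda>_def[symmetric] w_def[symmetric] algebra_simps)
qed

text \<open>The derivatives of the transition functions of \<open>e\<close> and \<open>s\<close> cancel: they contribute \<open>k L'/L\<close> and
\<open>(k/2)(-2 L'/L)\<close> times the same product.\<close>

theorem lie_derivative_in_mero_sections:
  assumes R: "riemann_surface R" and L: "theta_characteristic R L" and A: "finite A"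
    and e: "e \<in> mero_sections R (bundle_power L (-2)) A"
    and s: "s \<in> mero_sections R (bundle_power L k) A"
  shows "lie_derivative R k e s \<in> mero_sections R (bundle_power L k) A"
  unfolding mero_sections_def
proof (intro CollectI conjI allI impI ballI)
  fix \<alpha> x assume "\<not> (\<alpha> \<in> charts R \<and> x \<in> patch R \<alpha> - A)"
  then show "lie_derivative R k e s \<alpha> x = 0"
    using mero_sectionsD(1)[OF e] mero_sectionsD(1)[OF s] by (simp add: lie_derivative_def)
next
  fix \<alpha> \<beta> x
  assume ab: "\<alpha> \<in> charts R" "\<beta> \<in> charts R" and x: "x \<in> (patch R \<alpha> \<inter> patch R \<beta>) - A"
  have nz: "L \<alpha> \<beta> x \<noteq> 0"
    using L x ab unfolding theta_characteristic_def line_bundle_def by auto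
  define \<mu> d where "\<mu> = L \<alpha> \<beta> x" and "d = deriv (L \<alpha> \<beta> \<circ> chart_inv R \<alpha>) (coord R \<alpha> x)"
  have \<mu>: "\<mu> \<noteq> 0" using nz by (simp add: \<mu>_def)
  have "\<mu> powi (-2) = 1 / \<mu> ^ 2" "\<mu> powi (-3) = 1 / \<mu> ^ 3"
    by (simp_all add: power_int_minus divide_simps)
  then have e_\<alpha>: "e \<alpha> x = e \<beta> x / \<mu> ^ 2"
    "sect_deriv R e \<alpha> x = sect_deriv R e \<beta> x - 2 * d * e \<beta> x / \<mu> ^ 3"
    using mero_sectionsD(2)[OF e ab x] sect_deriv_transform[OF R L A e ab x]
    by (simp_all add: bundle_power_def \<mu>_def d_def)
  have "\<mu> powi (k - 1) = \<mu> powi k / \<mu>" "\<mu> powi (k + 2) = \<mu> powi k * \<mu> ^ 2"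
    using \<mu> by (simp_all add: power_int_add power_int_diff)
  then have s_\<alpha>: "s \<alpha> x = \<mu> powi k * s \<beta> x"
    "sect_deriv R s \<alpha> x = \<mu> powi k * (of_int k * d * s \<beta> x / \<mu> + \<mu> ^ 2 * sect_deriv R s \<beta> x)"
    using mero_sectionsD(2)[OF s ab x] sect_deriv_transform[OF R L A s ab x]
    by (simp_all add: bundle_power_def \<mu>_def d_def algebra_simps)
  have "lie_derivative R k e s \<alpha> x = \<mu> powi k * lie_derivative R k e s \<beta> x"
    unfolding lie_derivative_def e_\<alpha> s_\<alpha> using \<mu>
    by (simp add: field_simps power2_eq_square power3_eq_cube)
  then show "lie_derivative R k e s \<alpha> x = bundle_power L k \<alpha> \<beta> x * lie_derivative R k e s \<beta> x"
    by (simp add: bundle_power_def \<mu>_def)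
next
  fix \<alpha> assume a: "\<alpha> \<in> charts R"
  have eq: "local_rep R \<alpha> (lie_derivative R k e s) w =
      local_rep R \<alpha> e w * deriv (local_rep R \<alpha> s) w
        + of_int k / 2 * local_rep R \<alpha> s w * deriv (local_rep R \<alpha> e) w"
    if "w \<in> coord R \<alpha> ` patch R \<alpha>" for w
    by (rule local_rep_lie_derivative[OF that])
  have op: "open (coord R \<alpha> ` patch R \<alpha>)" "open (coord R \<alpha> ` (patch R \<alpha> - A))"
    using open_coord_image_minus_finite[OF R a openin_patch[OF R a] order_refl] A
      open_coord_image[OF R a openin_patch[OF R a] order_refl] by auto
  show "local_rep R \<alpha> (lie_derivative R k e s) holomorphic_on coord R \<alpha> ` (patch R \<alpha> - A)"
  proof (rule holomorphic_transform)
    show "(\<lambda>w. local_rep R \<alpha> e w * deriv (local_rep R \<alpha> s) w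
        + of_int k / 2 * local_rep R \<alpha> s w * deriv (local_rep R \<alpha> e) w)
        holomorphic_on coord R \<alpha> ` (patch R \<alpha> - A)"
      by (intro holomorphic_intros holomorphic_deriv mero_sectionsD(3)[OF e a]
          mero_sectionsD(3)[OF s a] op)
  qed (use eq in auto)
  have "(\<lambda>w. local_rep R \<alpha> e w * deriv (local_rep R \<alpha> s) w
        + of_int k / 2 * local_rep R \<alpha> s w * deriv (local_rep R \<alpha> e) w)
        meromorphic_on coord R \<alpha> ` patch R \<alpha>"
    by (intro meromorphic_intros mero_sectionsD(4)[OF e a] mero_sectionsD(4)[OF s a])
  then show "local_rep R \<alpha> (lie_derivative R k e s) meromorphic_on coord R \<alpha> ` patch R \<alpha>"
    by (rule meromorphic_on_cong[THEN iffD1, rotated -1])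
      (use eq op(1) in \<open>auto intro!: eventually_at_in_open[THEN eventually_mono]\<close>)
qed

section \<open>Laurent expansions of sections\<close>

lemma fls_times_nth_below:
  fixes F G :: "'a::semiring_0 fls"
  assumes "\<forall>j<a. fls_nth F j = 0" "\<forall>j<b. fls_nth G j = 0" "n < a + b"
  shows "fls_nth (F * G) n = 0"
proof (cases "F = 0 \<or> G = 0")
  case False
  then have "a \<le> fls_subdegree F" "b \<le> fls_subdegree G"
    using assms(1,2) by (auto intro: fls_subdegree_geI)
  then show ?thesis using assms(3) by (intro fls_times_nth_eq0) simp
qed auto

text \<open>Dividing by \<open>z\<^sup>n\<close> reduces to a function with limit \<open>1\<close> at the origin, whose expansion cannot have
a principal part.\<close>

lemma fls_nth_from_leading_asymptotics:
  assumes F: "f has_laurent_expansion F"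
    and O: "(\<lambda>w. f w / w powi n - 1) \<in> O[at 0](\<lambda>w. w)"
  shows "fls_nth F n = 1" and "\<forall>j<n. fls_nth F j = 0"
proof -
  define G where "G = fls_shift n F"
  have G: "(\<lambda>w. f w / w powi n) has_laurent_expansion G"
  proof -
    have "(\<lambda>w. f w * w powi (-n)) has_laurent_expansion F * fls_X_intpow (-n)"
      by (intro laurent_expansion_intros F)
    then show ?thesis
      using fls_X_intpow_times_conv_shift(2)[of F "- n"]
      by (simp add: G_def power_int_minus divide_inverse)
  qed
  obtain c where "\<forall>\<^sub>F w in at 0. norm (f w / w powi n - 1) \<le> c * norm w"
    using O by (auto elim: landau_o.bigE)
  moreover have "((\<lambda>w::complex. c * norm w) \<longlongrightarrow> 0) (at 0)"
    by (auto intro!: tendsto_eq_intros)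
  ultimately have "((\<lambda>w. f w / w powi n - 1) \<longlongrightarrow> 0) (at 0)"
    by (rule Lim_null_comparison)
  then have lim: "((\<lambda>w. f w / w powi n) \<longlongrightarrow> 1) (at 0)"
    using LIM_zero_iff by blast
  have sub: "fls_subdegree G \<ge> 0"
  proof (rule ccontr)
    assume "\<not> fls_subdegree G \<ge> 0"
    then have "filterlim (\<lambda>w. f w / w powi n) at_infinity (at 0)"
      using has_laurent_expansion_imp_filterlim_infinity_0[OF G] by simp
    with lim show False
      using not_tendsto_and_filterlim_at_infinity[of "at (0::complex)"] by auto
  qed
  have "fls_nth G 0 = 1"
    using has_laurent_expansion_imp_tendsto_0[OF G sub] lim tendsto_unique[of "at (0::complex)"] by auto
  then show "fls_nth F n = 1" by (simp add: G_def)
  show "\<forall>j<n. fls_nth F j = 0"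
  proof (intro allI impI)
    fix j assume "j < n"
    then have "fls_nth G (j - n) = 0" using sub by (intro fls_eq0_below_subdegree) simp
    then show "fls_nth F j = 0" by (simp add: G_def)
  qed
qed

text \<open>The expansion at the origin of the chart, thus at the point whose local coordinate the chart is.\<close>

definition laurent_at :: "('a, 'i) surface \<Rightarrow> 'i \<Rightarrow> ('a, 'i) sect \<Rightarrow> complex fls" where
  "laurent_at R \<alpha> s = laurent_expansion (local_rep R \<alpha> s) 0"

lemma has_laurent_expansion_laurent_at:
  assumes "local_coordinate R \<alpha> x" "s \<in> mero_sections R B A"
  shows "local_rep R \<alpha> s has_laurent_expansion laurent_at R \<alpha> s"
proof -
  have "local_rep R \<alpha> s meromorphic_on coord R \<alpha> ` patch R \<alpha>" "0 \<in> coord R \<alpha> ` patch R \<alpha>"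
    using assms mero_sectionsD(4) by (force simp: local_coordinate_def)+
  then show ?thesis
    unfolding meromorphic_on_def laurent_at_def
    using laurent_expansion_0_eqI by fastforce
qed

lemma laurent_at_add:
  assumes "local_coordinate R \<alpha> x" "s \<in> mero_sections R B A" "t \<in> mero_sections R B A"
  shows "laurent_at R \<alpha> (s + t) = laurent_at R \<alpha> s + laurent_at R \<alpha> t"
proof -
  have "local_rep R \<alpha> (s + t) = (\<lambda>w. local_rep R \<alpha> s w + local_rep R \<alpha> t w)"
    by (simp add: local_rep_def fun_eq_iff)
  then have "local_rep R \<alpha> (s + t) has_laurent_expansion laurent_at R \<alpha> s + laurent_at R \<alpha> t"
    using assms by (simp add: has_laurent_expansion_add has_laurent_expansion_laurent_at)
  then show ?thesis unfolding laurent_at_def[of R \<alpha> "s + t"] by (rule laurent_expansion_0_eqI)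
qed

lemma laurent_at_scale:
  assumes "local_coordinate R \<alpha> x" "s \<in> mero_sections R B A"
  shows "laurent_at R \<alpha> (sect_scale a s) = fls_const a * laurent_at R \<alpha> s"
proof -
  have "local_rep R \<alpha> (sect_scale a s) = (\<lambda>w. a * local_rep R \<alpha> s w)"
    by (simp add: local_rep_def sect_scale_def fun_eq_iff)
  then have "local_rep R \<alpha> (sect_scale a s) has_laurent_expansion fls_const a * laurent_at R \<alpha> s"
    using assms by (simp add: has_laurent_expansion_cmult_left has_laurent_expansion_laurent_at)
  then show ?thesis unfolding laurent_at_def[of R \<alpha> "sect_scale a s"] by (rule laurent_expansion_0_eqI)
qed

definition fls_lie_derivative :: "int \<Rightarrow> complex fls \<Rightarrow> complex fls \<Rightarrow> complex fls" where
  "fls_lie_derivative k F G = F * fls_deriv G + fls_const (of_int k / 2) * G * fls_deriv F"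

lemma laurent_at_lie_derivative:
  assumes R: "riemann_surface R" and \<alpha>: "local_coordinate R \<alpha> x"
    and e: "e \<in> mero_sections R B A" and s: "s \<in> mero_sections R B' A"
  shows "laurent_at R \<alpha> (lie_derivative R k e s) = fls_lie_derivative k (laurent_at R \<alpha> e) (laurent_at R \<alpha> s)"
proof -
  have ch: "\<alpha> \<in> charts R" and "0 \<in> coord R \<alpha> ` patch R \<alpha>"
    using \<alpha> by (force simp: local_coordinate_def)+
  moreover have "open (coord R \<alpha> ` patch R \<alpha>)"
    using open_coord_image[OF R ch openin_patch[OF R ch]] by blast
  ultimately have "\<forall>\<^sub>F w in at 0. w \<in> coord R \<alpha> ` patch R \<alpha>"
    by (intro eventually_at_in_open')
  then have ev: "\<forall>\<^sub>F w in at 0. local_rep R \<alpha> e w * deriv (local_rep R \<alpha> s) w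
      + of_int k / 2 * local_rep R \<alpha> s w * deriv (local_rep R \<alpha> e) w
      = local_rep R \<alpha> (lie_derivative R k e s) w"
    by eventually_elim (simp add: local_rep_lie_derivative)
  have ex: "(\<lambda>w. local_rep R \<alpha> e w * deriv (local_rep R \<alpha> s) w
      + of_int k / 2 * local_rep R \<alpha> s w * deriv (local_rep R \<alpha> e) w)
      has_laurent_expansion fls_lie_derivative k (laurent_at R \<alpha> e) (laurent_at R \<alpha> s)"
    unfolding fls_lie_derivative_def
    by (intro laurent_expansion_intros has_laurent_expansion_laurent_at[OF \<alpha> e]
        has_laurent_expansion_laurent_at[OF \<alpha> s])
  have "local_rep R \<alpha> (lie_derivative R k e s)
      has_laurent_expansion fls_lie_derivative k (laurent_at R \<alpha> e) (laurent_at R \<alpha> s)"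
    by (rule has_laurent_expansion_cong[OF ev refl, THEN iffD1, OF ex])
  then show ?thesis unfolding laurent_at_def[of R \<alpha> "lie_derivative R k e s"]
    by (rule laurent_expansion_0_eqI)
qed

lemma laurent_at_nth_below_order:
  assumes \<alpha>: "local_coordinate R \<alpha> x" and s: "s \<in> mero_sections R B A"
    and ord: "ereal (of_int m) \<le> sect_ord R \<alpha> s x" and "j < m"
  shows "fls_nth (laurent_at R \<alpha> s) j = 0"
proof (cases "laurent_at R \<alpha> s = 0")
  case False
  have c0: "coord R \<alpha> x = 0" using \<alpha> by (simp add: local_coordinate_def)
  have L: "(\<lambda>w. local_rep R \<alpha> s (0 + w)) has_laurent_expansion laurent_at R \<alpha> s"
    using has_laurent_expansion_laurent_at[OF \<alpha> s] by simp
  have "\<not> (\<forall>\<^sub>F w in at 0. local_rep R \<alpha> s w = 0)"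
    using has_laurent_expansion_eventually_zero_iff[OF L] False by simp
  then have "m \<le> fls_subdegree (laurent_at R \<alpha> s)"
    using ord has_laurent_expansion_zorder[OF L False] by (simp add: sect_ord_def c0)
  then show ?thesis using \<open>j < m\<close> by (intro fls_eq0_below_subdegree) simp
qed simp

lemma fls_lie_nth_below:
  assumes "\<forall>j<a. fls_nth F j = 0" "\<forall>j<b. fls_nth G j = 0" "n < a + b - 1"
  shows "fls_nth (fls_lie_derivative k F G) n = 0"
proof -
  have "\<forall>j<a - 1. fls_nth (fls_deriv F) j = 0" "\<forall>j<b - 1. fls_nth (fls_deriv G) j = 0"
    using assms by auto
  then have "fls_nth (F * fls_deriv G) n = 0" "fls_nth (G * fls_deriv F) n = 0"
    using fls_times_nth_below[of a F "b - 1" "fls_deriv G" n]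
      fls_times_nth_below[of b G "a - 1" "fls_deriv F" n] assms by auto
  then show ?thesis by (simp add: fls_lie_derivative_def mult.assoc)
qed

text \<open>Replacing \<open>E\<close> by its leading term \<open>z\<close> changes the result in higher orders only, and \<open>z d/dz\<close> multiplies
\<open>z\<^sup>b (dz)\<^sup>k\<^sup>/\<^sup>2\<close> by \<open>b + k/2\<close>.\<close>

lemma fls_lie_leading_euler:
  assumes "\<forall>j<1. fls_nth E j = 0" "fls_nth E 1 = 1" "\<forall>j<b. fls_nth G j = 0"
  shows "fls_nth (fls_lie_derivative k E G) b = (of_int b + of_int k / 2) * fls_nth G b"
proof -
  define H where "H = E - fls_X"
  have H: "\<forall>j<2. fls_nth H j = 0"
  proof (intro allI impI)
    fix j :: int assume "j < 2"
    then have "j < 1 \<or> j = 1" by auto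
    then show "fls_nth H j = 0" using assms(1,2) by (auto simp: H_def)
  qed
  have E: "E = fls_X + H" by (simp add: H_def)
  have "fls_lie_derivative k E G = fls_lie_derivative k fls_X G + fls_lie_derivative k H G"
    by (simp add: fls_lie_derivative_def E algebra_simps)
  moreover have "fls_nth (fls_lie_derivative k H G) b = 0"
    by (rule fls_lie_nth_below[OF H assms(3)]) simp
  moreover have "fls_nth (fls_lie_derivative k fls_X G) b = (of_int b + of_int k / 2) * fls_nth G b"
    by (simp add: fls_lie_derivative_def fls_X_times_conv_shift algebra_simps)
  ultimately show ?thesis by simp
qed

lemma fls_lie_module:
  "fls_lie_derivative k (fls_lie_derivative (-2) F G) S = fls_lie_derivative k F (fls_lie_derivative k G S) - fls_lie_derivative k G (fls_lie_derivative k F S)"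
proof -
  have m: "fls_const (of_int (-2) / 2 :: complex) = -1"
    by (rule fls_eqI) simp
  show ?thesis
    unfolding fls_lie_derivative_def m by (simp add: algebra_simps)
qed

section \<open>Krichever-Novikov bases and the Euler field\<close>

interpretation sections: vector_space sect_scale
  by unfold_locales (auto simp: sect_scale_def fun_eq_iff algebra_simps)

text \<open>The order condition gives the coefficients of a basis element at the points other than its own, the
normalisation those at its own point. The basis is re-indexed by the order, which is the degree minus
\<open>lam\<close>; so the indices are integers for half-integral weights too.\<close>

lemma leading_basis_of_kn_bases:
  fixes f :: "real \<Rightarrow> real \<Rightarrow> nat \<Rightarrow> ('a, 'i) sect"
  assumes A: "A = P ` {1..K} \<union> Q ` {1..M}"
    and zeta: "\<And>p. p \<in> {1..K} \<Longrightarrow> local_coordinate R (zeta p) (P p)"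
    and kn: "kn_bases R L K P M Q zeta C f"
    and lam: "lam \<in> kn_weights"
    and J: "J_index lam = range (\<lambda>n::int. of_int n + lam)"
  shows "leading_basis sect_scale {1..K} (\<lambda>i j s. fls_nth (laurent_at R (zeta i) s) j)
    (F_space R L A lam) (\<lambda>n p. f lam (of_int n + lam) p)"
proof -
  let ?g = "\<lambda>n p. f lam (of_int n + lam) p"
  have "is_basis_of (\<lambda>(n, p). f lam n p) (J_index lam \<times> {1..K}) (F_space R L A lam)"
    using kn lam unfolding kn_bases_def A by blast
  moreover have "(\<lambda>(n, p). f lam n p) ` (J_index lam \<times> {1..K}) = {?g n p | n p. p \<in> {1..K}}"
    unfolding J by fastforce
  ultimately have F: "F_space R L A lam = sections.span {?g n p | n p. p \<in> {1..K}}"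
    by (simp add: is_basis_of_def)
  have mem: "?g n p \<in> F_space R L A lam" if "p \<in> {1..K}" for n p
    unfolding F using that by (intro sections.span_base) blast
  have in_J: "of_int n + lam \<in> J_index lam" for n unfolding J by blast
  have ord: "ereal (of_int (n + 1 - of_bool (i = p))) \<le> sect_ord R (zeta i) (?g n p) (P i)"
    if "i \<in> {1..K}" "p \<in> {1..K}" for n i p
  proof -
    have "\<forall>i\<in>{1..K}. \<forall>\<alpha>\<in>charts R. P i \<in> patch R \<alpha> \<longrightarrow>
        ereal ((of_int n + lam + 1 - lam) - of_bool (i = p)) \<le> sect_ord R \<alpha> (?g n p) (P i)"
      using kn lam in_J[of n] that(2) unfolding kn_bases_def by blast
    then show ?thesis using zeta[OF that(1)] that(1) by (simp add: local_coordinate_def)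
  qed
  have off: "fls_nth (laurent_at R (zeta i) (?g n p)) j = 0"
    if "i \<in> {1..K}" "p \<in> {1..K}" "i \<noteq> p" "j < n + 1" for i p j n
    by (rule laurent_at_nth_below_order[OF zeta[OF that(1)] mem[OF that(2), unfolded F_space_def]
          ord[OF that(1,2)]]) (use that in simp)
  have on: "fls_nth (laurent_at R (zeta p) (?g n p)) n = 1"
    "\<forall>j<n. fls_nth (laurent_at R (zeta p) (?g n p)) j = 0" if "p \<in> {1..K}" for n p
  proof -
    have "(\<lambda>w. local_rep R (zeta p) (?g n p) w / w powi \<lfloor>of_int n + lam - lam\<rfloor> - 1) \<in> O[at 0](\<lambda>w. w)"
      using kn lam in_J[of n] that unfolding kn_bases_def by blast
    then have *: "(\<lambda>w. local_rep R (zeta p) (?g n p) w / w powi n - 1) \<in> O[at 0](\<lambda>w. w)"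
      by simp
    note exp = has_laurent_expansion_laurent_at[OF zeta[OF that] mem[OF that, unfolded F_space_def]]
    show "fls_nth (laurent_at R (zeta p) (?g n p)) n = 1"
      "\<forall>j<n. fls_nth (laurent_at R (zeta p) (?g n p)) j = 0"
      using fls_nth_from_leading_asymptotics[OF exp *] by blast+
  qed
  show ?thesis
  proof unfold_locales
    fix n j :: int and p i assume p: "p \<in> {1..K}" and i: "i \<in> {1..K}"
    show "fls_nth (laurent_at R (zeta i) (?g n p)) j = 0" if "j < n"
      using off[OF i p, of j n] on(2)[OF p, of n] that by (cases "i = p") auto
    show "fls_nth (laurent_at R (zeta i) (?g n p)) n = of_bool (i = p)"
      using off[OF i p, of n n] on(1)[OF p, of n] by (cases "i = p") auto
  next
    fix x y i j assume "x \<in> F_space R L A lam" "y \<in> F_space R L A lam" "i \<in> {1..K}"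
    then show "fls_nth (laurent_at R (zeta i) (x + y)) j =
        fls_nth (laurent_at R (zeta i) x) j + fls_nth (laurent_at R (zeta i) y) j"
      unfolding F_space_def by (simp add: laurent_at_add[OF zeta])
  next
    fix x i j a assume "x \<in> F_space R L A lam" "i \<in> {1..K}"
    then show "fls_nth (laurent_at R (zeta i) (sect_scale a x)) j =
        a * fls_nth (laurent_at R (zeta i) x) j"
      unfolding F_space_def by (simp add: laurent_at_scale[OF zeta])
  qed (simp_all add: F)
qed

lemma sect_scale_apply: "sect_scale a s \<alpha> x = a * s \<alpha> x"
  by (simp add: sect_scale_def)

text \<open>Holomorphy off \<open>A\<close> enters here: differentiation is linear only where the derivatives exist.\<close>

lemma sect_deriv_linear:
  assumes R: "riemann_surface R" and A: "finite A" and \<alpha>: "\<alpha> \<in> charts R" and x: "x \<in> patch R \<alpha> - A"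
    and s: "s \<in> mero_sections R B A"
  shows "t \<in> mero_sections R B A \<Longrightarrow> sect_deriv R (s + t) \<alpha> x = sect_deriv R s \<alpha> x + sect_deriv R t \<alpha> x"
    and "sect_deriv R (sect_scale a s) \<alpha> x = a * sect_deriv R s \<alpha> x"
proof -
  let ?U = "coord R \<alpha> ` (patch R \<alpha> - A)"
  have U: "open ?U" "coord R \<alpha> x \<in> ?U"
    using open_coord_image_minus_finite[OF R \<alpha> openin_patch[OF R \<alpha>] order_refl A] x by auto
  have diff: "local_rep R \<alpha> u field_differentiable at (coord R \<alpha> x)" if "u \<in> mero_sections R B A" for u
    using mero_sectionsD(3)[OF that \<alpha>] U holomorphic_on_imp_differentiable_at by blast
  have "local_rep R \<alpha> (sect_scale a s) = (\<lambda>w. a * local_rep R \<alpha> s w)"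
    by (simp add: local_rep_def sect_scale_def fun_eq_iff)
  then show "sect_deriv R (sect_scale a s) \<alpha> x = a * sect_deriv R s \<alpha> x"
    using diff[OF s] by (simp add: sect_deriv_def)
  have "local_rep R \<alpha> (s + t) = (\<lambda>w. local_rep R \<alpha> s w + local_rep R \<alpha> t w)"
    by (simp add: local_rep_def fun_eq_iff)
  then show "sect_deriv R (s + t) \<alpha> x = sect_deriv R s \<alpha> x + sect_deriv R t \<alpha> x"
    if "t \<in> mero_sections R B A"
    using diff[OF s] diff[OF that] by (simp add: sect_deriv_def)
qed

lemma lie_derivative_linear:
  assumes R: "riemann_surface R" and A: "finite A"
    and e: "e \<in> mero_sections R B A" and s: "s \<in> mero_sections R B' A"
  shows "e' \<in> mero_sections R B A \<Longrightarrow>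
      lie_derivative R k (e + e') s = lie_derivative R k e s + lie_derivative R k e' s"
    and "s' \<in> mero_sections R B' A \<Longrightarrow>
      lie_derivative R k e (s + s') = lie_derivative R k e s + lie_derivative R k e s'"
    and "lie_derivative R k (sect_scale a e) s = sect_scale a (lie_derivative R k e s)"
    and "lie_derivative R k e (sect_scale a s) = sect_scale a (lie_derivative R k e s)"
proof -
  have eqI: "u = v" if "\<And>\<alpha> x. \<alpha> \<in> charts R \<Longrightarrow> x \<in> patch R \<alpha> - A \<Longrightarrow> u \<alpha> x = v \<alpha> x"
    "\<And>\<alpha> x. \<not> (\<alpha> \<in> charts R \<and> x \<in> patch R \<alpha> - A) \<Longrightarrow> u \<alpha> x = v \<alpha> x" for u v :: "('a, 'b) sect"
    using that by blast
  note lin = sect_deriv_linear[OF R A] and zero = mero_sectionsD(1)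
  show "lie_derivative R k (sect_scale a e) s = sect_scale a (lie_derivative R k e s)"
    using zero[OF e] zero[OF s]
    by (intro eqI; simp add: lie_derivative_def lin(2)[OF _ _ e] sect_scale_apply algebra_simps)
  show "lie_derivative R k e (sect_scale a s) = sect_scale a (lie_derivative R k e s)"
    using zero[OF e] zero[OF s]
    by (intro eqI; simp add: lie_derivative_def lin(2)[OF _ _ s] sect_scale_apply algebra_simps)
  show "lie_derivative R k (e + e') s = lie_derivative R k e s + lie_derivative R k e' s"
    if "e' \<in> mero_sections R B A"
    using zero[OF e] zero[OF s] zero[OF that]
    by (intro eqI; simp add: lie_derivative_def lin(1)[OF _ _ e that] algebra_simps)
  show "lie_derivative R k e (s + s') = lie_derivative R k e s + lie_derivative R k e s'"
    if "s' \<in> mero_sections R B' A"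
    using zero[OF e] zero[OF s] zero[OF that]
    by (intro eqI; simp add: lie_derivative_def lin(1)[OF _ _ s that] algebra_simps)
qed

text \<open>The field \<open>E\<close> has the expansion \<open>z d/dz\<close> up to higher order at each of the marked points at once, so
it acts on leading coefficients by scalars that are the same at all points.\<close>

lemma semisimple_leading_action_of_vector_fields:
  fixes R :: "('a, 'i) surface" and zeta :: "nat \<Rightarrow> 'i" and I :: "nat set"
  defines "co \<equiv> \<lambda>i j s. fls_nth (laurent_at R (zeta i) s) j"
  assumes R: "riemann_surface R" and L: "theta_characteristic R L" and A: "finite A"
    and zeta: "\<And>p. p \<in> I \<Longrightarrow> local_coordinate R (zeta p) (P p)"
    and V: "leading_basis sect_scale I co (mero_sections R (bundle_power L (-2)) A) e"
    and W: "leading_basis sect_scale I co (mero_sections R (bundle_power L (-1)) A) \<phi>"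
    and E: "E = (\<Sum>p\<in>I. e 1 p)"
  shows "semisimple_leading_action sect_scale I co
    (mero_sections R (bundle_power L (-2)) A) e (mero_sections R (bundle_power L (-1)) A) \<phi>
    (vf_bracket R E) (vf_action R) E (\<lambda>a. of_int a - 1) (\<lambda>b. of_int b - 1 / 2)"
proof -
  let ?V = "mero_sections R (bundle_power L (-2)) A" and ?W = "mero_sections R (bundle_power L (-1)) A"
  interpret V: leading_basis sect_scale I co ?V e by (rule V)
  interpret W: leading_basis sect_scale I co ?W \<phi> by (rule W)
  have E_sum: "E = (\<Sum>p\<in>I. sect_scale 1 (e 1 p))" by (simp add: E)
  have E_fil: "E \<in> V.fil 1"
    unfolding E_sum
    by (intro sections.subspace_sum[OF V.subspace_fil] sections.subspace_scale[OF V.subspace_fil] V.g_in_fil) auto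
  then have E_V: "E \<in> ?V" by (rule V.fil_W)
  have E_lead: "fls_nth (laurent_at R (zeta i) E) 1 = 1" if "i \<in> I" for i
  proof -
    have "co i 1 E = (\<Sum>p\<in>I. 1 * co i 1 (e 1 p))"
      unfolding E_sum
      using V.co_sum[OF that, where t = I and v = "e 1" and u = "\<lambda>_. 1" and j = 1] V.g_in_W
      by simp
    also have "\<dots> = (\<Sum>p\<in>I. if p = i then 1 else 0)"
      using that by (intro sum.cong) (auto simp: V.co_lead)
    also have "\<dots> = 1" using that V.finite_I by simp
    finally show ?thesis by (simp add: co_def)
  qed
  have lie: "laurent_at R (zeta i) (lie_derivative R k f s)
      = fls_lie_derivative k (laurent_at R (zeta i) f) (laurent_at R (zeta i) s)"
    if "i \<in> I" "f \<in> ?V" "s \<in> mero_sections R (bundle_power L k) A" for i k f s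
    by (rule laurent_at_lie_derivative[OF R zeta that(2,3)]) (rule that(1))
  have closed: "lie_derivative R k f s \<in> mero_sections R (bundle_power L k) A"
    if "f \<in> ?V" "s \<in> mero_sections R (bundle_power L k) A" for k f s
    by (rule lie_derivative_in_mero_sections[OF R L A that])
  have below: "co i n (lie_derivative R k f s) = 0"
    if "i \<in> I" "f \<in> V.fil a" "s \<in> mero_sections R (bundle_power L k) A"
      "\<forall>i\<in>I. \<forall>j<b. co i j s = 0" "n < a + b - 1" for i n k f s a b
  proof -
    have "\<forall>j<a. fls_nth (laurent_at R (zeta i) f) j = 0"
      using that(1,2) unfolding V.fil_def by (simp add: co_def)
    moreover have "\<forall>j<b. fls_nth (laurent_at R (zeta i) s) j = 0"
      using that(1,4) by (simp add: co_def)
    ultimately show ?thesis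
      unfolding co_def lie[OF that(1) V.fil_W[OF that(2)] that(3)]
      using that(5) by (rule fls_lie_nth_below)
  qed
  have lead: "co i b (lie_derivative R k E s) = (of_int b + of_int k / 2) * co i b s"
    if "i \<in> I" "s \<in> mero_sections R (bundle_power L k) A" "\<forall>i\<in>I. \<forall>j<b. co i j s = 0" for i b k s
  proof -
    have "\<forall>j<1. fls_nth (laurent_at R (zeta i) E) j = 0"
      using that(1) E_fil unfolding V.fil_def by (simp add: co_def)
    moreover have "\<forall>j<b. fls_nth (laurent_at R (zeta i) s) j = 0"
      using that(1,3) by (simp add: co_def)
    ultimately show ?thesis
      unfolding co_def lie[OF that(1) E_V that(2)] using E_lead[OF that(1)]
      by (intro fls_lie_leading_euler)
  qed
  show ?thesis
  proof unfold_locales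
    show "E \<in> V.fil 1" by (rule E_fil)
  next
    fix f a assume f: "f \<in> V.fil a"
    show "vf_bracket R E f \<in> V.fil a"
      using f below[OF _ E_fil, of _ f "-2" a] closed[OF E_V, of f "-2"]
      by (auto simp: V.fil_def vf_bracket_eq)
    show "co i a (vf_bracket R E f) = (of_int a - 1) * co i a f" if "i \<in> I" for i
      using lead[OF that, of f "-2" a] f by (simp add: V.fil_def vf_bracket_eq)
  next
    fix f s a b assume f: "f \<in> V.fil a" and s: "s \<in> W.fil b"
    show "vf_action R f s \<in> W.fil (a + b - 1)"
      using s below[OF _ f, of _ s "-1" b] closed[OF V.fil_W[OF f], of s "-1"]
      by (auto simp: W.fil_def vf_action_eq)
  next
    fix s b i assume "s \<in> W.fil b" "i \<in> I"
    then show "co i b (vf_action R E s) = (of_int b - 1 / 2) * co i b s"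
      using lead[of i s "-1" b] by (simp add: W.fil_def vf_action_eq)
  next
    fix f s i j assume fs: "f \<in> ?V" "s \<in> ?W" and i: "i \<in> I"
    show "co i j (vf_action R (vf_bracket R E f) s) =
        co i j (vf_action R E (vf_action R f s)) - co i j (vf_action R f (vf_action R E s))"
      using i fs E_V closed[OF E_V fs(1)] closed[OF fs] closed[OF E_V fs(2)]
      by (simp add: co_def vf_action_eq vf_bracket_eq lie fls_lie_module)
  next
    fix b :: int
    have "2 * b \<noteq> 1" by presburger
    then have "of_int (2 * b) \<noteq> (of_int 1 :: complex)" unfolding of_int_eq_iff .
    then show "of_int b - 1 / 2 \<noteq> (0 :: complex)" by (simp add: field_simps)
  next
    fix a b :: int
    have "2 * (a + b) \<noteq> 3" by presburger
    then have "of_int (2 * (a + b)) \<noteq> (of_int 3 :: complex)" unfolding of_int_eq_iff .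
    then show "of_int a - 1 + (of_int b - 1 / 2) \<noteq> (0 :: complex)"
      by (simp add: field_simps)
  qed (simp_all add: vf_action_eq lie_derivative_linear[OF R A])
qed

section \<open>Odd cocycles\<close>

lemma minus_half_not_Int: "-1/2 \<notin> (\<int> :: real set)"
proof
  assume "-1/2 \<in> (\<int> :: real set)"
  then obtain n where "-1/2 = real_of_int n" by (elim Ints_cases)
  then have "real_of_int (2 * n) = real_of_int (-1)" by simp
  then show False unfolding of_int_eq_iff by presburger
qed

lemma J_index_minus_one: "J_index (-1) = range (\<lambda>n::int. of_int n + (-1))"
proof -
  have "x \<in> range (\<lambda>n::int. of_int n + (-1))" if "x \<in> \<int>" for x :: real
  proof -
    obtain n where "x = of_int n" using \<open>x \<in> \<int>\<close> by (elim Ints_cases)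
    then show ?thesis by (intro range_eqI[of _ _ "n + 1"]) simp
  qed
  then show ?thesis by (auto simp: J_index_def)
qed

lemma J_index_minus_half: "J_index (-1/2) = range (\<lambda>n::int. of_int n + (-1/2))"
proof -
  have "x \<in> range (\<lambda>n::int. of_int n + (-1/2))" if "x - 1/2 \<in> \<int>" for x :: real
  proof -
    obtain n where "x - 1/2 = of_int n" using \<open>x - 1/2 \<in> \<int>\<close> by (elim Ints_cases)
    then show ?thesis by (intro range_eqI[of _ _ "n + 1"]) simp
  qed
  moreover have "of_int n + (-1/2) - 1/2 \<in> (\<int> :: real set)" for n :: int
  proof -
    have "of_int n + (-1/2) - 1/2 = (of_int (n - 1) :: real)" by simp
    then show ?thesis using Ints_of_int by metis
  qed
  ultimately show ?thesis using minus_half_not_Int by (auto simp: J_index_def)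
qed

lemma F_space_minus_one: "F_space R L A (-1) = mero_sections R (bundle_power L (-2)) A"
  by (simp add: F_space_def)

lemma F_space_minus_half: "F_space R L A (-1/2) = mero_sections R (bundle_power L (-1)) A"
  using floor_of_int[of "-1", where ?'a = real] by (simp add: F_space_def)

lemma zero_in_F_space: "0 \<in> F_space R L A lam"
  by (auto simp: F_space_def mero_sections_def local_rep_def o_def)

lemma S_space_iff: "(g, \<psi>) \<in> S_space R L A \<longleftrightarrow> g \<in> F_space R L A (-1) \<and> \<psi> \<in> F_space R L A (-1/2)"
  by (simp add: S_space_def)

lemma S_bilinearD:
  assumes "S_bilinear R L A c" "x \<in> S_space R L A" "x' \<in> S_space R L A" "y \<in> S_space R L A"
  shows "c (x + x') y = c x y + c x' y" "c y (x + x') = c y x + c y x'"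
    and "c (S_scale a x) y = a * c x y" "c y (S_scale a x) = a * c y x"
  using assms unfolding S_bilinear_def S_linear_def by blast+

lemma odd_supercocycle_mixed_bilinear:
  assumes c: "odd_supercocycle R L A c"
    and g: "g \<in> F_space R L A (-1)" and \<psi>: "\<psi> \<in> F_space R L A (-1/2)"
  shows "h \<in> F_space R L A (-1) \<Longrightarrow> c (g + h, 0) (0, \<psi>) = c (g, 0) (0, \<psi>) + c (h, 0) (0, \<psi>)"
    and "\<omega> \<in> F_space R L A (-1/2) \<Longrightarrow> c (g, 0) (0, \<psi> + \<omega>) = c (g, 0) (0, \<psi>) + c (g, 0) (0, \<omega>)"
    and "c (sect_scale a g, 0) (0, \<psi>) = a * c (g, 0) (0, \<psi>)"
    and "c (g, 0) (0, sect_scale a \<psi>) = a * c (g, 0) (0, \<psi>)"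
proof -
  have bil: "S_bilinear R L A c" using c by (simp add: odd_supercocycle_def)
  have mem: "(u, 0) \<in> S_space R L A" "(0, v) \<in> S_space R L A"
    if "u \<in> F_space R L A (-1)" "v \<in> F_space R L A (-1/2)" for u v
    using that by (simp_all add: S_space_iff zero_in_F_space)
  note G = mem(1)[OF _ \<psi>] and \<Psi> = mem(2)[OF g]
  show "c (g + h, 0) (0, \<psi>) = c (g, 0) (0, \<psi>) + c (h, 0) (0, \<psi>)" if "h \<in> F_space R L A (-1)"
    using S_bilinearD(1)[OF bil G[OF g] G[OF that] \<Psi>[OF \<psi>]] by simp
  show "c (g, 0) (0, \<psi> + \<omega>) = c (g, 0) (0, \<psi>) + c (g, 0) (0, \<omega>)"
    if "\<omega> \<in> F_space R L A (-1/2)"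
    using S_bilinearD(2)[OF bil \<Psi>[OF \<psi>] \<Psi>[OF that] G[OF g]] by simp
  show "c (sect_scale a g, 0) (0, \<psi>) = a * c (g, 0) (0, \<psi>)"
    using S_bilinearD(3)[OF bil G[OF g] G[OF g] \<Psi>[OF \<psi>], of a]
    by (simp add: S_scale_def sections.scale_zero_right)
  show "c (g, 0) (0, sect_scale a \<psi>) = a * c (g, 0) (0, \<psi>)"
    using S_bilinearD(4)[OF bil \<Psi>[OF \<psi>] \<Psi>[OF \<psi>] G[OF g], of a]
    by (simp add: S_scale_def sections.scale_zero_right)
qed

lemma S_parity_mem:
  "g \<in> F_space R L A (-1) \<Longrightarrow> (g, 0) \<in> S_parity R L A 0"
  "\<psi> \<in> F_space R L A (-1/2) \<Longrightarrow> (0, \<psi>) \<in> S_parity R L A 1"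
  by (simp_all add: S_parity_def)

lemma odd_supercocycle_odd_even:
  assumes c: "odd_supercocycle R L A c"
    and "g \<in> F_space R L A (-1)" "\<psi> \<in> F_space R L A (-1/2)"
  shows "c (0, \<psi>) (g, 0) = - c (g, 0) (0, \<psi>)"
proof -
  have "c (0, \<psi>) (g, 0) = - ((-1) ^ (1 * 0)) * c (g, 0) (0, \<psi>)"
    using c S_parity_mem(1)[OF assms(2)] S_parity_mem(2)[OF assms(3)]
    unfolding odd_supercocycle_def by blast
  then show ?thesis by simp
qed

lemma odd_supercocycle_by_mixed_part:
  assumes c: "odd_supercocycle R L A c" and x: "x \<in> S_space R L A" and y: "y \<in> S_space R L A"
  shows "c x y = c (fst x, 0) (0, snd y) - c (fst y, 0) (0, snd x)"
proof -
  obtain g \<psi> h \<omega> where x: "x = (g, \<psi>)" "g \<in> F_space R L A (-1)" "\<psi> \<in> F_space R L A (-1/2)"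
    and y: "y = (h, \<omega>)" "h \<in> F_space R L A (-1)" "\<omega> \<in> F_space R L A (-1/2)"
    using x y by (auto simp: S_space_def)
  have bil: "S_bilinear R L A c" using c by (simp add: odd_supercocycle_def)
  have even: "c (g, 0) (h, 0) = 0"
    using c S_parity_mem(1)[OF x(2)] S_parity_mem(1)[OF y(2)] unfolding odd_supercocycle_def by blast
  have odd: "c (0, \<psi>) (0, \<omega>) = 0"
    using c S_parity_mem(2)[OF x(3)] S_parity_mem(2)[OF y(3)] unfolding odd_supercocycle_def by blast
  have "c x y = c ((g, 0) + (0, \<psi>)) ((h, 0) + (0, \<omega>))" by (simp add: x y)
  also have "\<dots> = c (g, 0) (h, 0) + c (g, 0) (0, \<omega>) + (c (0, \<psi>) (h, 0) + c (0, \<psi>) (0, \<omega>))"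
    using x y by (subst S_bilinearD[OF bil] | simp add: S_space_iff zero_in_F_space)+
  also have "\<dots> = c (g, 0) (0, \<omega>) - c (h, 0) (0, \<psi>)"
    using even odd odd_supercocycle_odd_even[OF c y(2) x(3)] by simp
  finally show ?thesis by (simp add: x y)
qed

text \<open>
This is the cocycle condition for two even elements and an odd one. The signs are all positive,
and the last of the three terms is turned around by antisymmetry.\<close>

lemma odd_supercocycle_mixed_cocycle:
  assumes R: "riemann_surface R" and L: "theta_characteristic R L" and A: "finite A"
    and c: "odd_supercocycle R L A c"
    and e: "e \<in> F_space R L A (-1)" and g: "g \<in> F_space R L A (-1)"
    and \<psi>: "\<psi> \<in> F_space R L A (-1/2)"
  shows "c (vf_bracket R e g, 0) (0, \<psi>) =
    c (e, 0) (0, vf_action R g \<psi>) - c (g, 0) (0, vf_action R e \<psi>)"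
proof -
  have "sect_deriv R (0 :: ('a, 'b) sect) = 0"
    by (simp add: sect_deriv_def local_rep_def fun_eq_iff o_def)
  then have br: "S_bracket R (g, 0) (0, \<psi>) = (0, vf_action R g \<psi>)"
    "S_bracket R (0, \<psi>) (e, 0) = (0, sect_scale (-1) (vf_action R e \<psi>))"
    "S_bracket R (e, 0) (g, 0) = (vf_bracket R e g, 0)"
    by (simp_all add: S_bracket_def vf_bracket_def vf_action_def sect_mult_def sect_scale_def
        fun_eq_iff)
  have closed: "vf_bracket R e g \<in> F_space R L A (-1)" "vf_action R e \<psi> \<in> F_space R L A (-1/2)"
    using lie_derivative_in_mero_sections[OF R L A] e g \<psi>
    unfolding F_space_minus_one F_space_minus_half vf_bracket_eq vf_action_eq by blast+
  have "(-1) ^ (0 * 1) * c (e, 0) (S_bracket R (g, 0) (0, \<psi>)) +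
      (-1) ^ (0 * 0) * c (g, 0) (S_bracket R (0, \<psi>) (e, 0)) +
      (-1) ^ (1 * 0) * c (0, \<psi>) (S_bracket R (e, 0) (g, 0)) = 0"
    using c S_parity_mem(1)[OF e] S_parity_mem(1)[OF g] S_parity_mem(2)[OF \<psi>]
    unfolding odd_supercocycle_def by blast
  then show ?thesis
    unfolding br
    using odd_supercocycle_odd_even[OF c closed(1) \<psi>]
      odd_supercocycle_mixed_bilinear(4)[OF c g closed(2), of "-1"]
    by (simp add: algebra_simps)
qed

theorem theorem5p6:
  fixes R :: "('a, 'i) surface" and L :: "('a, 'i) trans_funs"
    and A :: "'a set" and K M :: nat and P Q :: "nat \<Rightarrow> 'a"
    and zeta :: "nat \<Rightarrow> 'i" and C :: "'a chain"
    and f :: "real \<Rightarrow> real \<Rightarrow> nat \<Rightarrow> ('a, 'i) sect"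
    and c :: "('a, 'i) selem \<Rightarrow> ('a, 'i) selem \<Rightarrow> complex"
  assumes "compact_riemann_surface R"
    and "theta_characteristic R L"
    and "1 \<le> K" and "1 \<le> M"
    and "inj_on P {1..K}" and "inj_on Q {1..M}"
    and "P ` {1..K} \<inter> Q ` {1..M} = {}"
    and "A = P ` {1..K} \<union> Q ` {1..M}" and "A \<subseteq> topspace (base R)"
    and "\<And>p. p \<in> {1..K} \<Longrightarrow> local_coordinate R (zeta p) (P p)"
    and "separating_cycle R A K zeta C"
    and "kn_bases R L K P M Q zeta C f"
    and "odd_supercocycle R L A c"
    and "bounded_cocycle K f c"
  shows "is_coboundary R L A c"
proof -
  let ?L = "F_space R L A (-1)" and ?F = "F_space R L A (-1/2)"
  let ?I = "{1..K}"
  let ?co = "\<lambda>i j s. fls_nth (laurent_at R (zeta i) s) j"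
  have R: "riemann_surface R" using assms(1) by (simp add: compact_riemann_surface_def)
  have A: "finite A" by (simp add: assms(8))
  \<comment> \<open>Indexed by the order at the in-points, which exceeds the degree by \<open>1\<close> for vector fields and by
    \<open>1/2\<close> for \<open>(-1/2)\<close>-forms.\<close>
  define e where "e = (\<lambda>n p. f (-1) (of_int n + (-1)) p)"
  define \<phi> where "\<phi> = (\<lambda>n p. f (-1/2) (of_int n + (-1/2)) p)"
  have V: "leading_basis sect_scale ?I ?co ?L e"
    unfolding e_def
    by (rule leading_basis_of_kn_bases[OF assms(8,10,12) _ J_index_minus_one])
      (simp_all add: kn_weights_def)
  have W: "leading_basis sect_scale ?I ?co ?F \<phi>"
    unfolding \<phi>_def
    by (rule leading_basis_of_kn_bases[OF assms(8,10,12) _ J_index_minus_half])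
      (simp_all add: kn_weights_def)
  define E where "E = (\<Sum>p\<in>?I. e 1 p)"
  interpret semisimple_leading_action sect_scale ?I ?co ?L e ?F \<phi>
    "vf_bracket R E" "vf_action R" E "\<lambda>a. of_int a - 1" "\<lambda>b. of_int b - 1 / 2"
    unfolding F_space_minus_one F_space_minus_half
    by (rule semisimple_leading_action_of_vector_fields[OF R assms(2) A assms(10)
          V[unfolded F_space_minus_one] W[unfolded F_space_minus_half] E_def])
  define \<gamma> where "\<gamma> g \<psi> = c (g, 0) (0, \<psi>)" for g \<psi>
  note bil = odd_supercocycle_mixed_bilinear[OF assms(13), folded \<gamma>_def]
  obtain M2 :: int where M2: "\<And>n m x y. \<lbrakk>n \<in> half_ints; m \<in> half_ints; x \<in> S_degree K f n;
      y \<in> S_degree K f m; c x y \<noteq> 0\<rbrakk> \<Longrightarrow> n + m \<le> of_int M2"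
    using assms(14) unfolding bounded_cocycle_def by blast
  \<comment> \<open>The total order is the total degree plus \<open>3/2\<close>, so total orders from \<open>M2 + 2\<close> on exceed the
    bound.\<close>
  have basis_bounded: "\<gamma> (e n p) (\<phi> m q) = 0"
    if "M2 + 2 \<le> n + m" "p \<in> ?I" "q \<in> ?I" for n m p q
  proof (rule ccontr)
    assume nz: "\<gamma> (e n p) (\<phi> m q) \<noteq> 0"
    let ?n = "of_int n + (-1) :: real" and ?m = "of_int m + (-1/2) :: real"
    have int: "?n \<in> \<int>" using J_index_minus_one by (auto simp: J_index_def)
    have nint: "?m \<notin> \<int>"
    proof
      assume "?m \<in> \<int>"
      then have "?m - of_int m \<in> \<int>" by (intro Ints_diff) auto
      then show False using minus_half_not_Int by simp
    qed
    have h: "?n \<in> half_ints" "?m \<in> half_ints"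
    proof -
      have "2 * ?n = of_int (2 * n - 2)" "2 * ?m = of_int (2 * m - 1)" by simp_all
      then show "?n \<in> half_ints" "?m \<in> half_ints"
        unfolding half_ints_def using Ints_of_int by (metis (mono_tags) mem_Collect_eq)+
    qed
    have "(e n p, 0) \<in> S_degree K f ?n"
      using int that(2) by (auto simp: S_degree_def F_degree_def e_def intro!: sections.span_base)
    moreover have "(0, \<phi> m q) \<in> S_degree K f ?m"
      using nint that(3) by (auto simp: S_degree_def F_degree_def \<phi>_def intro!: sections.span_base)
    ultimately have "?n + ?m \<le> of_int M2" using M2[OF h] nz by (simp add: \<gamma>_def)
    moreover have "real_of_int (M2 + 2) \<le> real_of_int (n + m)" using that(1) by (simp only: of_int_le_iff)
    ultimately show False by simp
  qed
  have bounded: "\<gamma> g \<psi> = 0" if "M2 + 2 \<le> a + b" "g \<in> V.fil a" "\<psi> \<in> W.fil b" for a b g \<psi>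
    using that(3)
  proof (rule W.zero_on_fil[rotated 3])
    fix m q assume m: "b \<le> m" "q \<in> ?I"
    show "\<gamma> g (\<phi> m q) = 0"
      using that(2)
    proof (rule V.zero_on_fil[rotated 3])
      show "\<gamma> (e n p) (\<phi> m q) = 0" if "a \<le> n" "p \<in> ?I" for n p
        using basis_bounded[of n m p q] that m \<open>M2 + 2 \<le> a + b\<close> by linarith
    qed (blast intro: bil W.g_in_W[OF m(2)])+
  qed (blast intro: bil V.fil_W[OF that(2)])+
  have "\<exists>\<kappa>. Vector_Spaces.linear sect_scale (*) \<kappa> \<and> (\<forall>g\<in>?L. \<forall>\<psi>\<in>?F. \<gamma> g \<psi> = \<kappa> (vf_action R g \<psi>))"
  proof (rule bounded_cocycle_is_coboundary[of \<gamma> "M2 + 2"])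
    show "\<gamma> g \<psi> = 0" if "M2 + 2 \<le> a + b" "g \<in> V.fil a" "\<psi> \<in> W.fil b" for a b g \<psi>
      by (rule bounded[OF that])
    show "\<gamma> (vf_bracket R E g) \<psi> = \<gamma> E (vf_action R g \<psi>) - \<gamma> g (vf_action R E \<psi>)"
      if "g \<in> ?L" "\<psi> \<in> ?F" for g \<psi>
      unfolding \<gamma>_def by (rule odd_supercocycle_mixed_cocycle[OF R assms(2) A assms(13) E_V that])
  qed (blast intro: bil)+
  then obtain \<kappa> where lin: "Vector_Spaces.linear sect_scale (*) \<kappa>"
    and \<kappa>: "\<And>g \<psi>. \<lbrakk>g \<in> ?L; \<psi> \<in> ?F\<rbrakk> \<Longrightarrow> \<gamma> g \<psi> = \<kappa> (vf_action R g \<psi>)"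
    by blast
  interpret \<kappa>: Vector_Spaces.linear sect_scale "(*)" \<kappa> by (rule lin)
  show ?thesis
    unfolding is_coboundary_def
  proof (intro exI[of _ "\<lambda>x. \<kappa> (snd x)"] conjI ballI)
    show "S_linear R L A (\<lambda>x. \<kappa> (snd x))"
      by (simp add: S_linear_def S_scale_def \<kappa>.add \<kappa>.scale)
  next
    fix x y assume xy: "x \<in> S_space R L A" "y \<in> S_space R L A"
    then have "c x y = \<gamma> (fst x) (snd y) - \<gamma> (fst y) (snd x)"
      using odd_supercocycle_by_mixed_part[OF assms(13)] by (simp add: \<gamma>_def)
    also have "\<dots> = \<kappa> (vf_action R (fst x) (snd y) - vf_action R (fst y) (snd x))"
      using xy \<kappa> by (simp add: S_space_def mem_Times_iff \<kappa>.diff)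
    finally show "c x y = \<kappa> (snd (S_bracket R x y))"
      by (simp add: S_bracket_def)
  qed
qed

end
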